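(* Let $G\colon\mathcal{A}\to\mathcal{B}$ be a representably small functor between locally small categories, with $\mathcal{B}$ complete. Then the pushforward $G_\#T$ exists for any monad $T$ on $\mathcal{A}$.
   Context: A functor $P\colon\mathcal{A}\to\mathsf{Set}$ is small if it is a small colimit of representables; $G\colon\mathcal{A}\to\mathcal{B}$ is representably small if $\mathcal{B}(b,G-)\colon\mathcal{A}\to\mathsf{Set}$ is small for every $b\in\mathcal{B}$. The pushforward $G_\#T$ is, when it exists, the right Kan extension $(G_\#T,\varepsilon\colon(G_\#T)G\to GT)$ of $GT$ along $G$, with the unique monad structure on $\mathcal{B}$ such that $\varepsilon\cdot\eta^{G_\#T}G=G\eta^T$ and $\varepsilon\cdot\mu^{G_\#T}G=G\mu^T\cdot\varepsilon T\cdot(G_\#T)\varepsilon$. *)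

theory Defs
  imports Main "HOL-Library.FuncSet"
begin

unbundle cardinal_syntax

section \<open>Smallness\<close>

text \<open>
  The type \<open>'u\<close> plays the part of the class of all sets: hom-sets are subsets of \<open>'u\<close>, and a
  subset of \<open>'u\<close> is small if it has fewer elements than \<open>'u\<close> itself. The predicate \<open>universe\<close>
  says that the cardinality of \<open>'u\<close> is infinite, regular and a strong limit, so that the small
  subsets of \<open>'u\<close> are, up to bijection, the members of a Grothendieck universe. Uncountability is
  not required; \<open>universe_nat\<close> below is the case where small means finite.
\<close>

definition universe :: "'u itself \<Rightarrow> bool" where
  "universe (_ :: 'u itself) \<longleftrightarrow>
     infinite (UNIV :: 'u set) \<and>
     regularCard |UNIV :: 'u set| \<and>
     (\<forall>X :: 'u set. |X| <o |UNIV :: 'u set| \<longrightarrow> |Pow X| <o |UNIV :: 'u set| )"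

definition small :: "'u set \<Rightarrow> bool" where
  "small X \<longleftrightarrow> |X| <o |UNIV :: 'u set|"


section \<open>Categories, functors, natural transformations\<close>

text \<open>
  Distinct hom-sets are not required to be disjoint, so identities and composition carry the
  objects as arguments: \<open>Comp C x y z g f\<close> is the composite of \<open>f : x \<rightarrow> y\<close> and \<open>g : y \<rightarrow> z\<close>.
\<close>

record ('o, 'h) cat =
  Obj :: "'o set"
  Hom :: "'o \<Rightarrow> 'o \<Rightarrow> 'h set"
  Ident :: "'o \<Rightarrow> 'h"
  Comp :: "'o \<Rightarrow> 'o \<Rightarrow> 'o \<Rightarrow> 'h \<Rightarrow> 'h \<Rightarrow> 'h"

definition category :: "('o, 'h) cat \<Rightarrow> bool" where
  "category C \<longleftrightarrow>
     (\<forall>x\<in>Obj C. Ident C x \<in> Hom C x x) \<and>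
     (\<forall>x\<in>Obj C. \<forall>y\<in>Obj C. \<forall>z\<in>Obj C. \<forall>f\<in>Hom C x y. \<forall>g\<in>Hom C y z.
        Comp C x y z g f \<in> Hom C x z) \<and>
     (\<forall>x\<in>Obj C. \<forall>y\<in>Obj C. \<forall>f\<in>Hom C x y.
        Comp C x x y f (Ident C x) = f \<and> Comp C x y y (Ident C y) f = f) \<and>
     (\<forall>w\<in>Obj C. \<forall>x\<in>Obj C. \<forall>y\<in>Obj C. \<forall>z\<in>Obj C.
        \<forall>f\<in>Hom C w x. \<forall>g\<in>Hom C x y. \<forall>h\<in>Hom C y z.
        Comp C w x z (Comp C x y z h g) f = Comp C w y z h (Comp C w x y g f))"

definition locally_small :: "('o, 'u) cat \<Rightarrow> bool" where
  "locally_small C \<longleftrightarrow> category C \<and> (\<forall>x\<in>Obj C. \<forall>y\<in>Obj C. small (Hom C x y))"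

definition small_category :: "('u, 'u) cat \<Rightarrow> bool" where
  "small_category C \<longleftrightarrow> locally_small C \<and> small (Obj C)"

definition iso_objects :: "('o, 'h) cat \<Rightarrow> 'o \<Rightarrow> 'o \<Rightarrow> bool" where
  "iso_objects C x y \<longleftrightarrow> x \<in> Obj C \<and> y \<in> Obj C \<and>
     (\<exists>f\<in>Hom C x y. \<exists>g\<in>Hom C y x.
        Comp C x y x g f = Ident C x \<and> Comp C y x y f g = Ident C y)"

text \<open>
  Functors are not normalised outside the objects and morphisms of their domain, so a
  mathematical functor is represented by several (isomorphic) objects of \<open>functor_category\<close>.
  Natural transformations are normalised to be undefined outside the objects of the domain, and
  equality between them is the mathematical one.
\<close>

record ('o, 'h, 'p, 'k) functr =
  FObj :: "'o \<Rightarrow> 'p"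
  FHom :: "'o \<Rightarrow> 'o \<Rightarrow> 'h \<Rightarrow> 'k"

definition is_functor ::
  "('o, 'h) cat \<Rightarrow> ('p, 'k) cat \<Rightarrow> ('o, 'h, 'p, 'k) functr \<Rightarrow> bool" where
  "is_functor C D F \<longleftrightarrow>
     (\<forall>x\<in>Obj C. FObj F x \<in> Obj D) \<and>
     (\<forall>x\<in>Obj C. \<forall>y\<in>Obj C. \<forall>f\<in>Hom C x y. FHom F x y f \<in> Hom D (FObj F x) (FObj F y)) \<and>
     (\<forall>x\<in>Obj C. FHom F x x (Ident C x) = Ident D (FObj F x)) \<and>
     (\<forall>x\<in>Obj C. \<forall>y\<in>Obj C. \<forall>z\<in>Obj C. \<forall>f\<in>Hom C x y. \<forall>g\<in>Hom C y z.
        FHom F x z (Comp C x y z g f)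
          = Comp D (FObj F x) (FObj F y) (FObj F z) (FHom F y z g) (FHom F x y f))"

definition id_functor :: "('o, 'h, 'o, 'h) functr" where
  "id_functor = \<lparr>FObj = (\<lambda>x. x), FHom = (\<lambda>x y f. f)\<rparr>"

definition comp_functor ::
  "('p, 'k, 'q, 'l) functr \<Rightarrow> ('o, 'h, 'p, 'k) functr \<Rightarrow> ('o, 'h, 'q, 'l) functr"
  (infixl "\<circ>\<^sub>F" 70) where
  "G \<circ>\<^sub>F F = \<lparr>FObj = (\<lambda>x. FObj G (FObj F x)),
             FHom = (\<lambda>x y f. FHom G (FObj F x) (FObj F y) (FHom F x y f))\<rparr>"

definition nat_trans ::
  "('o, 'h) cat \<Rightarrow> ('p, 'k) cat \<Rightarrow> ('o, 'h, 'p, 'k) functr \<Rightarrow> ('o, 'h, 'p, 'k) functr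
     \<Rightarrow> ('o \<Rightarrow> 'k) \<Rightarrow> bool" where
  "nat_trans C D F G \<tau> \<longleftrightarrow>
     \<tau> \<in> extensional (Obj C) \<and>
     (\<forall>x\<in>Obj C. \<tau> x \<in> Hom D (FObj F x) (FObj G x)) \<and>
     (\<forall>x\<in>Obj C. \<forall>y\<in>Obj C. \<forall>f\<in>Hom C x y.
        Comp D (FObj F x) (FObj G x) (FObj G y) (FHom G x y f) (\<tau> x)
          = Comp D (FObj F x) (FObj F y) (FObj G y) (\<tau> y) (FHom F x y f))"

definition functor_category ::
  "('o, 'h) cat \<Rightarrow> ('p, 'k) cat \<Rightarrow> (('o, 'h, 'p, 'k) functr, 'o \<Rightarrow> 'k) cat" where
  "functor_category C D =
     \<lparr>Obj = {F. is_functor C D F},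
      Hom = (\<lambda>F G. {\<tau>. nat_trans C D F G \<tau>}),
      Ident = (\<lambda>F. \<lambda>x\<in>Obj C. Ident D (FObj F x)),
      Comp = (\<lambda>F G H \<sigma> \<tau>. \<lambda>x\<in>Obj C. Comp D (FObj F x) (FObj G x) (FObj H x) (\<sigma> x) (\<tau> x))\<rparr>"


section \<open>Limits and colimits\<close>

definition is_cone ::
  "('o, 'h) cat \<Rightarrow> ('j, 'i) cat \<Rightarrow> ('j, 'i, 'o, 'h) functr \<Rightarrow> 'o \<Rightarrow> ('j \<Rightarrow> 'h) \<Rightarrow> bool" where
  "is_cone C J D c \<pi> \<longleftrightarrow>
     c \<in> Obj C \<and>
     (\<forall>j\<in>Obj J. \<pi> j \<in> Hom C c (FObj D j)) \<and>
     (\<forall>i\<in>Obj J. \<forall>j\<in>Obj J. \<forall>u\<in>Hom J i j.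
        Comp C c (FObj D i) (FObj D j) (FHom D i j u) (\<pi> i) = \<pi> j)"

definition is_limit ::
  "('o, 'h) cat \<Rightarrow> ('j, 'i) cat \<Rightarrow> ('j, 'i, 'o, 'h) functr \<Rightarrow> 'o \<Rightarrow> ('j \<Rightarrow> 'h) \<Rightarrow> bool" where
  "is_limit C J D c \<pi> \<longleftrightarrow>
     is_cone C J D c \<pi> \<and>
     (\<forall>c' \<pi>'. is_cone C J D c' \<pi>' \<longrightarrow>
        (\<exists>!h. h \<in> Hom C c' c \<and> (\<forall>j\<in>Obj J. Comp C c' c (FObj D j) (\<pi> j) h = \<pi>' j)))"

definition is_cocone ::
  "('o, 'h) cat \<Rightarrow> ('j, 'i) cat \<Rightarrow> ('j, 'i, 'o, 'h) functr \<Rightarrow> 'o \<Rightarrow> ('j \<Rightarrow> 'h) \<Rightarrow> bool" where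
  "is_cocone C J D c \<kappa> \<longleftrightarrow>
     c \<in> Obj C \<and>
     (\<forall>j\<in>Obj J. \<kappa> j \<in> Hom C (FObj D j) c) \<and>
     (\<forall>i\<in>Obj J. \<forall>j\<in>Obj J. \<forall>u\<in>Hom J i j.
        Comp C (FObj D i) (FObj D j) c (\<kappa> j) (FHom D i j u) = \<kappa> i)"

definition is_colimit ::
  "('o, 'h) cat \<Rightarrow> ('j, 'i) cat \<Rightarrow> ('j, 'i, 'o, 'h) functr \<Rightarrow> 'o \<Rightarrow> ('j \<Rightarrow> 'h) \<Rightarrow> bool" where
  "is_colimit C J D c \<kappa> \<longleftrightarrow>
     is_cocone C J D c \<kappa> \<and>
     (\<forall>c' \<kappa>'. is_cocone C J D c' \<kappa>' \<longrightarrow>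
        (\<exists>!h. h \<in> Hom C c c' \<and> (\<forall>j\<in>Obj J. Comp C (FObj D j) c c' h (\<kappa> j) = \<kappa>' j)))"

text \<open>
  Every small category is isomorphic to one whose objects are elements of \<open>'u\<close>, so it is enough
  to let the indexing categories range over those.
\<close>

definition complete_category :: "('o, 'u) cat \<Rightarrow> bool" where
  "complete_category C \<longleftrightarrow>
     (\<forall>(J :: ('u, 'u) cat) D. small_category J \<and> is_functor J C D
        \<longrightarrow> (\<exists>c \<pi>. is_limit C J D c \<pi>))"


section \<open>Small functors\<close>

definition set_category :: "('u set, 'u \<Rightarrow> 'u) cat" where
  "set_category =
     \<lparr>Obj = {X. small X},
      Hom = (\<lambda>X Y. X \<rightarrow>\<^sub>E Y),
      Ident = (\<lambda>X. \<lambda>x\<in>X. x),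
      Comp = (\<lambda>X Y Z g f. compose X g f)\<rparr>"

definition hom_functor :: "('o, 'u) cat \<Rightarrow> 'o \<Rightarrow> ('o, 'u, 'u set, 'u \<Rightarrow> 'u) functr" where
  "hom_functor C a =
     \<lparr>FObj = (\<lambda>x. Hom C a x),
      FHom = (\<lambda>x y g. \<lambda>f\<in>Hom C a x. Comp C a x y g f)\<rparr>"

definition representable :: "('o, 'u) cat \<Rightarrow> ('o, 'u, 'u set, 'u \<Rightarrow> 'u) functr \<Rightarrow> bool" where
  "representable C P \<longleftrightarrow>
     (\<exists>a\<in>Obj C. iso_objects (functor_category C set_category) (hom_functor C a) P)"

definition small_functor :: "('o, 'u) cat \<Rightarrow> ('o, 'u, 'u set, 'u \<Rightarrow> 'u) functr \<Rightarrow> bool" where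
  "small_functor C P \<longleftrightarrow>
     (\<exists>(J :: ('u, 'u) cat) D \<kappa>.
        small_category J \<and>
        is_functor J (functor_category C set_category) D \<and>
        (\<forall>j\<in>Obj J. representable C (FObj D j)) \<and>
        is_colimit (functor_category C set_category) J D P \<kappa>)"

definition representably_small ::
  "('a, 'u) cat \<Rightarrow> ('b, 'u) cat \<Rightarrow> ('a, 'u, 'b, 'u) functr \<Rightarrow> bool" where
  "representably_small A B G \<longleftrightarrow>
     is_functor A B G \<and> (\<forall>b\<in>Obj B. small_functor A (hom_functor B b \<circ>\<^sub>F G))"


section \<open>Monads, Kan extensions, pushforwards\<close>

definition monad ::
  "('o, 'h) cat \<Rightarrow> ('o, 'h, 'o, 'h) functr \<Rightarrow> ('o \<Rightarrow> 'h) \<Rightarrow> ('o \<Rightarrow> 'h) \<Rightarrow> bool" where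
  "monad C T \<eta> \<mu> \<longleftrightarrow>
     is_functor C C T \<and>
     nat_trans C C id_functor T \<eta> \<and>
     nat_trans C C (T \<circ>\<^sub>F T) T \<mu> \<and>
     (\<forall>x\<in>Obj C.
        let t = FObj T x; tt = FObj T t; ttt = FObj T tt in
        Comp C t tt t (\<mu> x) (\<eta> t) = Ident C t \<and>
        Comp C t tt t (\<mu> x) (FHom T x t (\<eta> x)) = Ident C t \<and>
        Comp C ttt tt t (\<mu> x) (\<mu> t) = Comp C ttt tt t (\<mu> x) (FHom T tt t (\<mu> x)))"

text \<open>\<open>(R, \<epsilon>)\<close> is a right Kan extension of \<open>F : A \<rightarrow> D\<close> along \<open>G : A \<rightarrow> B\<close>, where \<open>\<epsilon> : R G \<rightarrow> F\<close>.\<close>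

definition right_kan_extension ::
  "('a, 'h) cat \<Rightarrow> ('b, 'k) cat \<Rightarrow> ('d, 'l) cat \<Rightarrow>
   ('a, 'h, 'b, 'k) functr \<Rightarrow> ('a, 'h, 'd, 'l) functr \<Rightarrow>
   ('b, 'k, 'd, 'l) functr \<Rightarrow> ('a \<Rightarrow> 'l) \<Rightarrow> bool" where
  "right_kan_extension A B D G F R \<epsilon> \<longleftrightarrow>
     is_functor B D R \<and>
     nat_trans A D (R \<circ>\<^sub>F G) F \<epsilon> \<and>
     (\<forall>H \<alpha>. is_functor B D H \<and> nat_trans A D (H \<circ>\<^sub>F G) F \<alpha> \<longrightarrow>
        (\<exists>!\<beta>. nat_trans B D H R \<beta> \<and>
           (\<forall>x\<in>Obj A. Comp D (FObj H (FObj G x)) (FObj R (FObj G x)) (FObj F x)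
                        (\<epsilon> x) (\<beta> (FObj G x)) = \<alpha> x)))"

text \<open>
  The equations \<open>\<epsilon> \<cdot> \<eta>'G = G\<eta>\<close> and \<open>\<epsilon> \<cdot> \<mu>'G = G\<mu> \<cdot> \<epsilon>T \<cdot> R\<epsilon>\<close> relating monads \<open>(T, \<eta>, \<mu>)\<close> on
  \<open>A\<close> and \<open>(R, \<eta>', \<mu>')\<close> on \<open>B\<close>, written out at each object of \<open>A\<close>.
\<close>

definition pushforward_equations ::
  "('a, 'h) cat \<Rightarrow> ('b, 'k) cat \<Rightarrow> ('a, 'h, 'b, 'k) functr \<Rightarrow>
   ('a, 'h, 'a, 'h) functr \<Rightarrow> ('a \<Rightarrow> 'h) \<Rightarrow> ('a \<Rightarrow> 'h) \<Rightarrow>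
   ('b, 'k, 'b, 'k) functr \<Rightarrow> ('a \<Rightarrow> 'k) \<Rightarrow> ('b \<Rightarrow> 'k) \<Rightarrow> ('b \<Rightarrow> 'k) \<Rightarrow> bool" where
  "pushforward_equations A B G T \<eta> \<mu> R \<epsilon> \<eta>' \<mu>' \<longleftrightarrow>
     (\<forall>x\<in>Obj A.
        let t = FObj T x; tt = FObj T t;
            g = FObj G x; gt = FObj G t; gtt = FObj G tt;
            rg = FObj R g; rgt = FObj R gt; rrg = FObj R rg in
        Comp B g rg gt (\<epsilon> x) (\<eta>' g) = FHom G x t (\<eta> x) \<and>
        Comp B rrg rg gt (\<epsilon> x) (\<mu>' g)
          = Comp B rrg gtt gt (FHom G tt t (\<mu> x))
              (Comp B rrg rgt gtt (\<epsilon> t) (FHom R rg gt (\<epsilon> x))))"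

definition is_pushforward ::
  "('a, 'h) cat \<Rightarrow> ('b, 'k) cat \<Rightarrow> ('a, 'h, 'b, 'k) functr \<Rightarrow>
   ('a, 'h, 'a, 'h) functr \<Rightarrow> ('a \<Rightarrow> 'h) \<Rightarrow> ('a \<Rightarrow> 'h) \<Rightarrow>
   ('b, 'k, 'b, 'k) functr \<Rightarrow> ('a \<Rightarrow> 'k) \<Rightarrow> ('b \<Rightarrow> 'k) \<Rightarrow> ('b \<Rightarrow> 'k) \<Rightarrow> bool" where
  "is_pushforward A B G T \<eta> \<mu> R \<epsilon> \<eta>' \<mu>' \<longleftrightarrow>
     right_kan_extension A B B G (G \<circ>\<^sub>F T) R \<epsilon> \<and>
     monad B R \<eta>' \<mu>' \<and>
     pushforward_equations A B G T \<eta> \<mu> R \<epsilon> \<eta>' \<mu>' \<and>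
     (\<forall>\<eta>'' \<mu>''. monad B R \<eta>'' \<mu>'' \<and> pushforward_equations A B G T \<eta> \<mu> R \<epsilon> \<eta>'' \<mu>''
        \<longrightarrow> \<eta>'' = \<eta>' \<and> \<mu>'' = \<mu>')"


section \<open>Basic facts\<close>

lemma universe_nat: "universe TYPE(nat)"
proof -
  have card_nat: "natLeq =o |UNIV :: nat set|"
    using card_of_nat ordIso_symmetric by blast
  have fin: "|X| <o |UNIV :: nat set| \<longleftrightarrow> finite X" for X :: "'x set"
    using card_nat card_of_nat finite_iff_ordLess_natLeq ordLess_ordIso_trans by blast
  have "regularCard |UNIV :: nat set|"
    using regularCard_ordIso[OF card_nat natLeq_Cinfinite regularCard_natLeq] .
  then show ?thesis
    by (simp add: universe_def fin)
qed

lemma category_functor_category: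
  assumes C: "category C" and D: "category D"
  shows "category (functor_category C D)"
proof -
  have d3: "Comp D w x z (Comp D x y z h g) f = Comp D w y z h (Comp D w x y g f)"
    if "w \<in> Obj D" "x \<in> Obj D" "y \<in> Obj D" "z \<in> Obj D"
       "f \<in> Hom D w x" "g \<in> Hom D x y" "h \<in> Hom D y z" for w x y z f g h
    using D that unfolding category_def by blast
  have d2: "Comp D x y z g f \<in> Hom D x z"
    if "x \<in> Obj D" "y \<in> Obj D" "z \<in> Obj D" "f \<in> Hom D x y" "g \<in> Hom D y z" for x y z f g
    using D that unfolding category_def by blast
  have d1: "Ident D x \<in> Hom D x x" if "x \<in> Obj D" for x
    using D that unfolding category_def by blast
  have dl: "Comp D x y y (Ident D y) f = f" and dr: "Comp D x x y f (Ident D x) = f"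
    if "x \<in> Obj D" "y \<in> Obj D" "f \<in> Hom D x y" for x y f
    using D that unfolding category_def by blast+
  have comp: "nat_trans C D F H (\<lambda>x\<in>Obj C. Comp D (FObj F x) (FObj G x) (FObj H x) (\<sigma> x) (\<tau> x))"
    if F: "is_functor C D F" and G: "is_functor C D G" and H: "is_functor C D H"
      and \<tau>: "nat_trans C D F G \<tau>" and \<sigma>: "nat_trans C D G H \<sigma>" for F G H \<sigma> \<tau>
    unfolding nat_trans_def
  proof (intro conjI ballI)
    fix x y f assume xy: "x \<in> Obj C" "y \<in> Obj C" and f: "f \<in> Hom C x y"
    note [simp] = xy
    have obs[simp]: "FObj F x \<in> Obj D" "FObj F y \<in> Obj D" "FObj G x \<in> Obj D" "FObj G y \<in> Obj D"
      "FObj H x \<in> Obj D" "FObj H y \<in> Obj D"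
      using F G H xy unfolding is_functor_def by auto
    have homs[simp]: "FHom F x y f \<in> Hom D (FObj F x) (FObj F y)"
      "FHom G x y f \<in> Hom D (FObj G x) (FObj G y)" "FHom H x y f \<in> Hom D (FObj H x) (FObj H y)"
      "\<tau> x \<in> Hom D (FObj F x) (FObj G x)" "\<tau> y \<in> Hom D (FObj F y) (FObj G y)"
      "\<sigma> x \<in> Hom D (FObj G x) (FObj H x)" "\<sigma> y \<in> Hom D (FObj G y) (FObj H y)"
      using F G H \<tau> \<sigma> xy f unfolding is_functor_def nat_trans_def by simp_all
    have n\<tau>: "Comp D (FObj F x) (FObj G x) (FObj G y) (FHom G x y f) (\<tau> x)
          = Comp D (FObj F x) (FObj F y) (FObj G y) (\<tau> y) (FHom F x y f)"
      using \<tau> xy f unfolding nat_trans_def by blast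
    have n\<sigma>: "Comp D (FObj G x) (FObj H x) (FObj H y) (FHom H x y f) (\<sigma> x)
          = Comp D (FObj G x) (FObj G y) (FObj H y) (\<sigma> y) (FHom G x y f)"
      using \<sigma> xy f unfolding nat_trans_def by blast
    let ?\<rho> = "\<lambda>x\<in>Obj C. Comp D (FObj F x) (FObj G x) (FObj H x) (\<sigma> x) (\<tau> x)"
    have "Comp D (FObj F x) (FObj H x) (FObj H y) (FHom H x y f) (?\<rho> x)
        = Comp D (FObj F x) (FObj G x) (FObj H y)
            (Comp D (FObj G x) (FObj H x) (FObj H y) (FHom H x y f) (\<sigma> x)) (\<tau> x)"
      by (simp add: d3)
    also have "\<dots> = Comp D (FObj F x) (FObj G y) (FObj H y) (\<sigma> y)
            (Comp D (FObj F x) (FObj G x) (FObj G y) (FHom G x y f) (\<tau> x))"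
      unfolding n\<sigma> by (simp add: d3)
    also have "\<dots> = Comp D (FObj F x) (FObj F y) (FObj H y) (?\<rho> y) (FHom F x y f)"
      unfolding n\<tau> by (simp add: d3)
    finally show "Comp D (FObj F x) (FObj H x) (FObj H y) (FHom H x y f) (?\<rho> x)
      = Comp D (FObj F x) (FObj F y) (FObj H y) (?\<rho> y) (FHom F x y f)" .
  qed (use F G H \<tau> \<sigma> in \<open>auto simp: is_functor_def nat_trans_def intro!: d2\<close>)
  have ident: "nat_trans C D F F (\<lambda>x\<in>Obj C. Ident D (FObj F x))" if F: "is_functor C D F" for F
    using F unfolding nat_trans_def is_functor_def by (auto simp: d1 dl dr)
  show ?thesis
    unfolding category_def
  proof (intro conjI ballI)
    fix F G \<tau>
    assume "F \<in> Obj (functor_category C D)" "G \<in> Obj (functor_category C D)"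
      "\<tau> \<in> Hom (functor_category C D) F G"
    then have *: "is_functor C D F" "is_functor C D G" "nat_trans C D F G \<tau>"
      by (auto simp: functor_category_def)
    then have "\<tau> \<in> extensional (Obj C)" by (simp add: nat_trans_def)
    then show "Comp (functor_category C D) F F G \<tau> (Ident (functor_category C D) F) = \<tau>"
      "Comp (functor_category C D) F G G (Ident (functor_category C D) G) \<tau> = \<tau>"
      using * unfolding functor_category_def is_functor_def nat_trans_def
      by (auto simp: dl dr intro!: extensionalityI[where A = "Obj C"])
  next
    fix F G H K \<tau> \<sigma> \<rho>
    assume "F \<in> Obj (functor_category C D)" "G \<in> Obj (functor_category C D)"
      "H \<in> Obj (functor_category C D)" "K \<in> Obj (functor_category C D)"
      "\<tau> \<in> Hom (functor_category C D) F G" "\<sigma> \<in> Hom (functor_category C D) G H"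
      "\<rho> \<in> Hom (functor_category C D) H K"
    then show "Comp (functor_category C D) F G K (Comp (functor_category C D) G H K \<rho> \<sigma>) \<tau>
      = Comp (functor_category C D) F H K \<rho> (Comp (functor_category C D) F G H \<sigma> \<tau>)"
      unfolding functor_category_def is_functor_def nat_trans_def
      by (auto intro!: restrict_ext d3)
  qed (use comp ident in \<open>auto simp: functor_category_def\<close>)
qed

lemma category_set_category: "category set_category"
  unfolding category_def set_category_def
  by (auto simp: compose_def PiE_iff extensional_def fun_eq_iff)

lemma is_functor_hom_functor:
  assumes "locally_small C" "a \<in> Obj C"
  shows "is_functor C set_category (hom_functor C a)"
proof -
  have C: "category C" using assms by (simp add: locally_small_def)
  have "Comp C a x z (Comp C x y z g f) e = Comp C a y z g (Comp C a x y f e)"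
    if "x \<in> Obj C" "y \<in> Obj C" "z \<in> Obj C" "e \<in> Hom C a x" "f \<in> Hom C x y" "g \<in> Hom C y z"
    for x y z e f g
    using C that assms(2) unfolding category_def by blast
  moreover have "Comp C a x y f e \<in> Hom C a y"
    if "x \<in> Obj C" "y \<in> Obj C" "e \<in> Hom C a x" "f \<in> Hom C x y" for x y e f
    using C that assms(2) unfolding category_def by blast
  moreover have "Comp C a x x (Ident C x) e = e" if "x \<in> Obj C" "e \<in> Hom C a x" for x e
    using C that assms(2) unfolding category_def by blast
  ultimately show ?thesis
    using assms unfolding is_functor_def hom_functor_def set_category_def locally_small_def
    by (auto simp: compose_def fun_eq_iff)
qed

lemma is_functor_comp_functor:
  assumes "is_functor C D F" "is_functor D E G"
  shows "is_functor C E (G \<circ>\<^sub>F F)"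
  using assms unfolding is_functor_def comp_functor_def by simp

end

theory Submission
  imports Defs
begin

text \<open>
  If \<open>B(b, G-)\<close> is a small colimit of representables \<open>A(a\<^sub>j, -)\<close>, then the limit of \<open>G T a\<^sub>j\<close> over the
  opposite of the index category is the limit of \<open>G T\<close> weighted by \<open>B(b, G-)\<close>; it exists since \<open>B\<close> is
  complete. These weighted limits are the values of the right Kan extension \<open>R\<close> of \<open>G T\<close> along \<open>G\<close>.
  The equations for the unit and the multiplication of \<open>R\<close> define them by the universal property of
  \<open>R\<close>, and each monad law holds because both of its sides have the same composite with \<open>\<epsilon>\<close>.
\<close>

section \<open>Categories and natural transformations\<close>

text \<open>The obstacle is size: as a limit over all pairs of an object \<open>x\<close> of
  \<open>A\<close> and a morphism \<open>b -> G x\<close>, the value \<open>R b\<close> would be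
  indexed by a category that may be large, and completeness says nothing about it. Smallness of
  \<open>B(b, G-)\<close> replaces these pairs by a small generating family, because a
  transformation out of a colimit of representables is, by the Yoneda lemma, a compatible choice of
  one element for each index. Compatibility is expressed by morphisms between the
  \<open>a\<^sub>j\<close> that run against the arrows of the index category, since
  \<open>A(a, -)\<close> is contravariant in \<open>a\<close>; hence the opposite. The limits for
  varying \<open>b\<close> fit together into a functor because the weight \<open>B(b, G-)\<close> is
  contravariant in \<open>b\<close>. Weighted limits and Kan extensions are treated for a general
  functor \<open>F : A -> D\<close>; the case of \<open>G T\<close> enters only with the
  monad.\<close>

lemma ident_in_hom: "category C \<Longrightarrow> x \<in> Obj C \<Longrightarrow> Ident C x \<in> Hom C x x"
  unfolding category_def by blast

lemma comp_in_hom: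
  "\<lbrakk>category C; x \<in> Obj C; y \<in> Obj C; z \<in> Obj C; f \<in> Hom C x y; g \<in> Hom C y z\<rbrakk>
    \<Longrightarrow> Comp C x y z g f \<in> Hom C x z"
  unfolding category_def by blast

lemma comp_ident:
  assumes "category C" "x \<in> Obj C" "y \<in> Obj C" "f \<in> Hom C x y"
  shows "Comp C x x y f (Ident C x) = f" "Comp C x y y (Ident C y) f = f"
  using assms unfolding category_def by blast+

lemma comp_assoc:
  "\<lbrakk>category C; w \<in> Obj C; x \<in> Obj C; y \<in> Obj C; z \<in> Obj C;
    f \<in> Hom C w x; g \<in> Hom C x y; h \<in> Hom C y z\<rbrakk>
    \<Longrightarrow> Comp C w x z (Comp C x y z h g) f = Comp C w y z h (Comp C w x y g f)"
  unfolding category_def by blast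

lemma functor_obj: "is_functor C D F \<Longrightarrow> x \<in> Obj C \<Longrightarrow> FObj F x \<in> Obj D"
  unfolding is_functor_def by blast

lemma functor_hom:
  "\<lbrakk>is_functor C D F; x \<in> Obj C; y \<in> Obj C; f \<in> Hom C x y\<rbrakk>
    \<Longrightarrow> FHom F x y f \<in> Hom D (FObj F x) (FObj F y)"
  unfolding is_functor_def by blast

lemma functor_ident:
  "is_functor C D F \<Longrightarrow> x \<in> Obj C \<Longrightarrow> FHom F x x (Ident C x) = Ident D (FObj F x)"
  unfolding is_functor_def by blast

lemma functor_comp:
  "\<lbrakk>is_functor C D F; x \<in> Obj C; y \<in> Obj C; z \<in> Obj C; f \<in> Hom C x y; g \<in> Hom C y z\<rbrakk>
    \<Longrightarrow> FHom F x z (Comp C x y z g f)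
      = Comp D (FObj F x) (FObj F y) (FObj F z) (FHom F y z g) (FHom F x y f)"
  unfolding is_functor_def by blast

lemma nat_trans_hom:
  "nat_trans C D F G \<tau> \<Longrightarrow> x \<in> Obj C \<Longrightarrow> \<tau> x \<in> Hom D (FObj F x) (FObj G x)"
  unfolding nat_trans_def by blast

lemma nat_trans_natural:
  "\<lbrakk>nat_trans C D F G \<tau>; x \<in> Obj C; y \<in> Obj C; f \<in> Hom C x y\<rbrakk>
    \<Longrightarrow> Comp D (FObj F x) (FObj G x) (FObj G y) (FHom G x y f) (\<tau> x)
      = Comp D (FObj F x) (FObj F y) (FObj G y) (\<tau> y) (FHom F x y f)"
  unfolding nat_trans_def by blast

lemma nat_trans_eqI:
  assumes "nat_trans C D F G \<tau>" "nat_trans C D F' G' \<sigma>" "\<And>x. x \<in> Obj C \<Longrightarrow> \<tau> x = \<sigma> x"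
  shows "\<tau> = \<sigma>"
  using assms unfolding nat_trans_def by (blast intro: extensionalityI)

lemma FObj_comp_functor [simp]: "FObj (G \<circ>\<^sub>F F) x = FObj G (FObj F x)"
  by (simp add: comp_functor_def)

lemma FHom_comp_functor [simp]:
  "FHom (G \<circ>\<^sub>F F) x y f = FHom G (FObj F x) (FObj F y) (FHom F x y f)"
  by (simp add: comp_functor_def)

lemma FObj_id_functor [simp]: "FObj id_functor x = x"
  by (simp add: id_functor_def)

lemma FHom_id_functor [simp]: "FHom id_functor x y f = f"
  by (simp add: id_functor_def)

text \<open>An equality of records without typing hypotheses, since functors are not normalised
  outside their domains. It allows the source and target of a whiskered transformation to be
  rebracketed by rewriting.\<close>

lemma comp_functor_assoc: "(H \<circ>\<^sub>F G) \<circ>\<^sub>F F = H \<circ>\<^sub>F (G \<circ>\<^sub>F F)"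
  by (simp add: comp_functor_def)

lemma comp_functor_id [simp]: "F \<circ>\<^sub>F id_functor = F" "id_functor \<circ>\<^sub>F F = F"
  by (simp_all add: comp_functor_def id_functor_def)

lemma restrict_eqD: "restrict f S = restrict g S \<Longrightarrow> x \<in> S \<Longrightarrow> f x = g x"
  by (metis restrict_apply')

lemma is_functor_id_functor: "is_functor C C id_functor"
  by (simp add: is_functor_def)

lemma nat_trans_ident:
  assumes "category C" "category D" "is_functor C D F"
  shows "nat_trans C D F F (\<lambda>x\<in>Obj C. Ident D (FObj F x))"
  using ident_in_hom[OF category_functor_category[OF assms(1,2)], of F] assms(3)
  by (simp add: functor_category_def)

lemma nat_trans_comp:
  assumes "category C" "category D" "is_functor C D F" "is_functor C D G" "is_functor C D H"
    and "nat_trans C D F G \<tau>" "nat_trans C D G H \<sigma>"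
  shows "nat_trans C D F H
    (\<lambda>x\<in>Obj C. Comp D (FObj F x) (FObj G x) (FObj H x) (\<sigma> x) (\<tau> x))"
  using comp_in_hom[OF category_functor_category[OF assms(1,2)], of F G H \<tau> \<sigma>] assms(3-)
  by (simp add: functor_category_def)

lemma nat_trans_whisker_left:
  assumes "is_functor C D F" "is_functor C D G" "is_functor D E H" "nat_trans C D F G \<tau>"
  shows "nat_trans C E (H \<circ>\<^sub>F F) (H \<circ>\<^sub>F G)
    (\<lambda>x\<in>Obj C. FHom H (FObj F x) (FObj G x) (\<tau> x))"
proof -
  note [simp] = functor_obj[OF assms(1)] functor_obj[OF assms(2)] functor_hom[OF assms(1)]
    functor_hom[OF assms(2)] functor_hom[OF assms(3)] nat_trans_hom[OF assms(4)]
    functor_comp[OF assms(3), symmetric] nat_trans_natural[OF assms(4)]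
  show ?thesis
    unfolding nat_trans_def by simp
qed

lemma nat_trans_whisker_right:
  assumes "is_functor C D H" "nat_trans D E F G \<tau>"
  shows "nat_trans C E (F \<circ>\<^sub>F H) (G \<circ>\<^sub>F H) (\<lambda>x\<in>Obj C. \<tau> (FObj H x))"
  using assms unfolding nat_trans_def is_functor_def by simp


section \<open>Set-valued functors\<close>

lemma
  assumes "is_functor C set_category P"
  shows set_functor_apply:
      "\<lbrakk>x \<in> Obj C; y \<in> Obj C; f \<in> Hom C x y; p \<in> FObj P x\<rbrakk> \<Longrightarrow> FHom P x y f p \<in> FObj P y"
    and set_functor_ident: "\<lbrakk>x \<in> Obj C; p \<in> FObj P x\<rbrakk> \<Longrightarrow> FHom P x x (Ident C x) p = p"
    and set_functor_comp:
      "\<lbrakk>x \<in> Obj C; y \<in> Obj C; z \<in> Obj C; f \<in> Hom C x y; g \<in> Hom C y z; p \<in> FObj P x\<rbrakk>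
        \<Longrightarrow> FHom P x z (Comp C x y z g f) p = FHom P y z g (FHom P x y f p)"
  using functor_hom[OF assms, of x y f] functor_ident[OF assms, of x]
    functor_comp[OF assms, of x y z f g]
  by (auto simp: set_category_def compose_def)

text \<open>Both sides of a naturality square are \<open>compose\<close> terms restricted to
  \<open>FObj P x\<close>, so their equality can be tested on the elements of that set.\<close>

lemma set_nat_trans_iff:
  assumes "is_functor C set_category P" "is_functor C set_category Q"
  shows "nat_trans C set_category P Q \<tau> \<longleftrightarrow>
    \<tau> \<in> extensional (Obj C) \<and> (\<forall>x\<in>Obj C. \<tau> x \<in> FObj P x \<rightarrow>\<^sub>E FObj Q x) \<and>
    (\<forall>x\<in>Obj C. \<forall>y\<in>Obj C. \<forall>f\<in>Hom C x y. \<forall>p\<in>FObj P x.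
      FHom Q x y f (\<tau> x p) = \<tau> y (FHom P x y f p))"
  unfolding nat_trans_def set_category_def
  by (auto simp: compose_def fun_eq_iff restrict_def)

lemma set_nat_trans_eqI:
  assumes "nat_trans C set_category P Q \<tau>" "nat_trans C set_category P Q \<sigma>"
    and "\<And>x p. x \<in> Obj C \<Longrightarrow> p \<in> FObj P x \<Longrightarrow> \<tau> x p = \<sigma> x p"
  shows "\<tau> = \<sigma>"
proof (rule nat_trans_eqI[OF assms(1,2)])
  fix x assume x: "x \<in> Obj C"
  show "\<tau> x = \<sigma> x"
    using nat_trans_hom[OF assms(1) x] nat_trans_hom[OF assms(2) x] assms(3)[OF x]
    by (auto simp: set_category_def intro: PiE_ext)
qed

text \<open>The pair \<open>(a, d)\<close> is a representation of \<open>P\<close> in elementary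
  form: \<open>d\<close> corresponds to a transformation from \<open>hom_functor C a\<close> to
  \<open>P\<close>, and the unique \<open>f\<close> says that it is bijective at every
  object.\<close>

definition universal_element ::
  "('o, 'h) cat \<Rightarrow> ('o, 'h, 'u set, 'u \<Rightarrow> 'u) functr \<Rightarrow> 'o \<Rightarrow> 'u \<Rightarrow> bool" where
  "universal_element C P a d \<longleftrightarrow> a \<in> Obj C \<and> d \<in> FObj P a \<and>
     (\<forall>x\<in>Obj C. \<forall>p\<in>FObj P x. \<exists>!f. f \<in> Hom C a x \<and> FHom P a x f d = p)"

text \<open>The universal element is the image of the identity of \<open>a\<close> under the
  isomorphism \<open>\<phi>\<close>: by naturality, \<open>f\<close> acts on it with result
  \<open>\<phi> x f\<close>, and \<open>\<phi> x\<close> is a bijection.\<close>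

lemma representable_universal_element:
  assumes C: "locally_small C" and "representable C P"
  shows "\<exists>a d. universal_element C P a d"
proof -
  have cat: "category C" using C by (simp add: locally_small_def)
  obtain a \<phi> \<psi> where a: "a \<in> Obj C" and P: "is_functor C set_category P"
    and \<phi>: "nat_trans C set_category (hom_functor C a) P \<phi>"
    and \<psi>: "nat_trans C set_category P (hom_functor C a) \<psi>"
    and inv: "(\<lambda>x\<in>Obj C. compose (Hom C a x) (\<psi> x) (\<phi> x)) = (\<lambda>x\<in>Obj C. \<lambda>f\<in>Hom C a x. f)"
      "(\<lambda>x\<in>Obj C. compose (FObj P x) (\<phi> x) (\<psi> x)) = (\<lambda>x\<in>Obj C. \<lambda>p\<in>FObj P x. p)"
    using assms(2) unfolding representable_def iso_objects_def functor_category_def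
    by (auto simp: set_category_def hom_functor_def)
  note H = is_functor_hom_functor[OF C a]
  have \<psi>\<phi>: "\<psi> x (\<phi> x f) = f" if "x \<in> Obj C" "f \<in> Hom C a x" for x f
    using fun_cong[OF fun_cong[OF inv(1), of x], of f] that by (simp add: compose_def)
  have \<phi>\<psi>: "\<phi> x (\<psi> x p) = p" if "x \<in> Obj C" "p \<in> FObj P x" for x p
    using fun_cong[OF fun_cong[OF inv(2), of x], of p] that by (simp add: compose_def)
  have \<phi>_in: "\<phi> x f \<in> FObj P x" if "x \<in> Obj C" "f \<in> Hom C a x" for x f
    using \<phi> that unfolding set_nat_trans_iff[OF H P] by (auto simp: hom_functor_def)
  have \<psi>_in: "\<psi> x p \<in> Hom C a x" if "x \<in> Obj C" "p \<in> FObj P x" for x p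
    using \<psi> that unfolding set_nat_trans_iff[OF P H] by (auto simp: hom_functor_def)
  have id: "Ident C a \<in> Hom C a a" using cat a by (rule ident_in_hom)
  have \<phi>_eq: "FHom P a x f (\<phi> a (Ident C a)) = \<phi> x f" if "x \<in> Obj C" "f \<in> Hom C a x" for x f
    using \<phi> that a id comp_ident[OF cat a that]
    unfolding set_nat_trans_iff[OF H P] by (auto simp: hom_functor_def)
  have "universal_element C P a (\<phi> a (Ident C a))"
    unfolding universal_element_def
  proof (intro conjI ballI a \<phi>_in id)
    fix x p assume "x \<in> Obj C" "p \<in> FObj P x"
    then show "\<exists>!f. f \<in> Hom C a x \<and> FHom P a x f (\<phi> a (Ident C a)) = p"
      by (metis \<phi>_eq \<phi>\<psi> \<psi>\<phi> \<psi>_in)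
  qed
  then show ?thesis by blast
qed

text \<open>Injectivity in the Yoneda lemma: every element of \<open>P\<close> is obtained from
  \<open>d\<close> by the action of a morphism, so naturality spreads the equality from
  \<open>d\<close> to all elements.\<close>

lemma universal_element_eqI:
  assumes P: "is_functor C set_category P" and Q: "is_functor C set_category Q"
    and d: "universal_element C P a d"
    and \<tau>: "nat_trans C set_category P Q \<tau>" and \<sigma>: "nat_trans C set_category P Q \<sigma>"
    and eq: "\<tau> a d = \<sigma> a d"
  shows "\<tau> = \<sigma>"
proof (rule set_nat_trans_eqI[OF \<tau> \<sigma>])
  fix x p assume x: "x \<in> Obj C" and "p \<in> FObj P x"
  then obtain f where f: "f \<in> Hom C a x" "FHom P a x f d = p"
    using d unfolding universal_element_def by blast
  have "a \<in> Obj C" "d \<in> FObj P a" using d by (simp_all add: universal_element_def)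
  then show "\<tau> x p = \<sigma> x p"
    using \<tau> \<sigma> x f eq unfolding set_nat_trans_iff[OF P Q] by metis
qed

text \<open>Surjectivity in the Yoneda lemma: write \<open>p\<close> as the action of a morphism
  \<open>l x p\<close> on \<open>d\<close> and send it to the action of the same morphism on
  \<open>q\<close>. Naturality follows from the uniqueness of \<open>l x p\<close>.\<close>

lemma universal_element_extend:
  assumes cat: "category C"
    and P: "is_functor C set_category P" and Q: "is_functor C set_category Q"
    and d: "universal_element C P a d" and q: "q \<in> FObj Q a"
  shows "\<exists>\<tau>. nat_trans C set_category P Q \<tau> \<and> \<tau> a d = q"
proof -
  have a: "a \<in> Obj C" and da: "d \<in> FObj P a" using d by (simp_all add: universal_element_def)
  define l where "l x p = (THE f. f \<in> Hom C a x \<and> FHom P a x f d = p)" for x p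
  have l: "l x p \<in> Hom C a x" "FHom P a x (l x p) d = p" if "x \<in> Obj C" "p \<in> FObj P x" for x p
    using d theI'[of "\<lambda>f. f \<in> Hom C a x \<and> FHom P a x f d = p"] that
    unfolding universal_element_def l_def by blast+
  have l_eq: "l x p = f" if "x \<in> Obj C" "f \<in> Hom C a x" "FHom P a x f d = p" for x p f
  proof -
    have "p \<in> FObj P x" using set_functor_apply[OF P a that(1,2) da] that(3) by simp
    then show ?thesis using l[OF that(1)] d that unfolding universal_element_def by blast
  qed
  define \<tau> where "\<tau> = (\<lambda>x\<in>Obj C. \<lambda>p\<in>FObj P x. FHom Q a x (l x p) q)"
  have "nat_trans C set_category P Q \<tau>"
    unfolding set_nat_trans_iff[OF P Q]
  proof (intro conjI ballI)
    fix x y f p assume x: "x \<in> Obj C" and y: "y \<in> Obj C" and f: "f \<in> Hom C x y"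
      and p: "p \<in> FObj P x"
    note lp = l[OF x p]
    have "l y (FHom P x y f p) = Comp C a x y f (l x p)"
      using set_functor_comp[OF P a x y lp(1) f da] comp_in_hom[OF cat a x y lp(1) f] lp(2) y
      by (simp add: l_eq)
    then show "FHom Q x y f (\<tau> x p) = \<tau> y (FHom P x y f p)"
      using set_functor_comp[OF Q a x y lp(1) f q] set_functor_apply[OF P x y f p] x y p
      by (simp add: \<tau>_def)
  qed (auto simp: \<tau>_def l q intro!: set_functor_apply[OF Q a])
  moreover have "\<tau> a d = q"
    using l_eq[OF a ident_in_hom[OF cat a] set_functor_ident[OF P a da]]
      set_functor_ident[OF Q a q] a da by (simp add: \<tau>_def)
  ultimately show ?thesis by blast
qed


section \<open>Limits weighted by a small functor\<close>

text \<open>\<open>weighted_cone A B D G F b c \<Lambda>\<close> says that \<open>\<Lambda>\<close> is a natural transformation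
  \<open>B(b, G-) \<rightarrow> D(c, F-)\<close>. It is stated without hom functors, so that local smallness is not needed.\<close>

definition weighted_cone ::
  "('a, 'h) cat \<Rightarrow> ('b, 'k) cat \<Rightarrow> ('d, 'l) cat \<Rightarrow>
   ('a, 'h, 'b, 'k) functr \<Rightarrow> ('a, 'h, 'd, 'l) functr \<Rightarrow> 'b \<Rightarrow> 'd \<Rightarrow> ('a \<Rightarrow> 'k \<Rightarrow> 'l) \<Rightarrow> bool" where
  "weighted_cone A B D G F b c \<Lambda> \<longleftrightarrow>
     c \<in> Obj D \<and>
     (\<forall>x\<in>Obj A. \<forall>h\<in>Hom B b (FObj G x). \<Lambda> x h \<in> Hom D c (FObj F x)) \<and>
     (\<forall>x\<in>Obj A. \<forall>y\<in>Obj A. \<forall>f\<in>Hom A x y. \<forall>h\<in>Hom B b (FObj G x).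
        Comp D c (FObj F x) (FObj F y) (FHom F x y f) (\<Lambda> x h)
          = \<Lambda> y (Comp B b (FObj G x) (FObj G y) (FHom G x y f) h))"

definition weighted_limit ::
  "('a, 'h) cat \<Rightarrow> ('b, 'k) cat \<Rightarrow> ('d, 'l) cat \<Rightarrow>
   ('a, 'h, 'b, 'k) functr \<Rightarrow> ('a, 'h, 'd, 'l) functr \<Rightarrow> 'b \<Rightarrow> 'd \<Rightarrow> ('a \<Rightarrow> 'k \<Rightarrow> 'l) \<Rightarrow> bool" where
  "weighted_limit A B D G F b c \<Lambda> \<longleftrightarrow>
     weighted_cone A B D G F b c \<Lambda> \<and>
     (\<forall>c' \<Lambda>'. weighted_cone A B D G F b c' \<Lambda>' \<longrightarrow>
        (\<exists>!k. k \<in> Hom D c' c \<and>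
           (\<forall>x\<in>Obj A. \<forall>h\<in>Hom B b (FObj G x). Comp D c' c (FObj F x) (\<Lambda> x h) k = \<Lambda>' x h)))"

definition opposite :: "('o, 'h) cat \<Rightarrow> ('o, 'h) cat" where
  "opposite C = \<lparr>Obj = Obj C, Hom = (\<lambda>x y. Hom C y x), Ident = Ident C,
     Comp = (\<lambda>x y z g f. Comp C z y x f g)\<rparr>"

lemma category_opposite: "category C \<Longrightarrow> category (opposite C)"
  unfolding category_def opposite_def by simp

lemma small_category_opposite: "small_category J \<Longrightarrow> small_category (opposite J)"
  using category_opposite[of J]
  by (auto simp: small_category_def locally_small_def opposite_def)

text \<open>A weighted cone may take any values outside its domain, whereas components of a
  transformation are undefined there; the restriction bridges the two. Uniqueness for
  transformations thereby becomes equality of cones at all relevant \<open>x\<close> and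
  \<open>h\<close>.\<close>

lemma weighted_cone_iff_nat_trans:
  assumes B: "locally_small B" and D: "locally_small D"
    and G: "is_functor A B G" and F: "is_functor A D F" and b: "b \<in> Obj B" and c: "c \<in> Obj D"
  shows "weighted_cone A B D G F b c \<Lambda> \<longleftrightarrow>
    nat_trans A set_category (hom_functor B b \<circ>\<^sub>F G) (hom_functor D c \<circ>\<^sub>F F)
      (\<lambda>x\<in>Obj A. \<lambda>h\<in>Hom B b (FObj G x). \<Lambda> x h)"
proof -
  have *: "Comp B b (FObj G x) (FObj G y) (FHom G x y f) h \<in> Hom B b (FObj G y)"
    if "x \<in> Obj A" "y \<in> Obj A" "f \<in> Hom A x y" "h \<in> Hom B b (FObj G x)" for x y f h
    using that B b by (auto simp: locally_small_def intro!: comp_in_hom functor_obj[OF G] functor_hom[OF G])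
  show ?thesis
    unfolding weighted_cone_def
      set_nat_trans_iff[OF is_functor_comp_functor[OF G is_functor_hom_functor[OF B b]]
        is_functor_comp_functor[OF F is_functor_hom_functor[OF D c]]]
    using c * by (simp add: hom_functor_def Pi_iff cong: conj_cong ball_cong)
qed

text \<open>By the universal property of the colimit and the Yoneda lemma, transformations from
  \<open>B(b, G-)\<close> to \<open>D(c, F-)\<close> are cones with vertex \<open>c\<close> over the objects \<open>F a\<^sub>j\<close>; that the colimit is
  computed objectwise is not needed.\<close>

lemma weighted_limit_exists:
  fixes A :: "('a, 'u) cat" and B :: "('b, 'u) cat" and D :: "('d, 'u) cat"
  assumes A: "locally_small A" and B: "locally_small B" and D: "locally_small D"
    and G: "is_functor A B G" and F: "is_functor A D F" and b: "b \<in> Obj B"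
    and small: "small_functor A (hom_functor B b \<circ>\<^sub>F G)"
    and complete: "complete_category D"
  shows "\<exists>c \<Lambda>. weighted_limit A B D G F b c \<Lambda>"
proof -
  define P where "P = hom_functor B b \<circ>\<^sub>F G"
  have catA: "category A" and catD: "category D"
    using A D by (simp_all add: locally_small_def)
  have P: "is_functor A set_category P"
    unfolding P_def by (intro is_functor_comp_functor[OF G] is_functor_hom_functor B b)
  have Q: "is_functor A set_category (hom_functor D c \<circ>\<^sub>F F)" if "c \<in> Obj D" for c
    by (intro is_functor_comp_functor[OF F] is_functor_hom_functor D that)
  define \<F> where "\<F> = functor_category A (set_category :: ('u set, 'u \<Rightarrow> 'u) cat)"
  obtain J :: "('u, 'u) cat" and W \<kappa> where J: "small_category J" and W: "is_functor J \<F> W"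
    and rep: "\<And>j. j \<in> Obj J \<Longrightarrow> representable A (FObj W j)" and colim: "is_colimit \<F> J W P \<kappa>"
    using small unfolding small_functor_def P_def \<F>_def by blast
  have catJ: "category J" using J by (simp add: small_category_def locally_small_def)
  have Wj: "is_functor A set_category (FObj W j)" if "j \<in> Obj J" for j
    using functor_obj[OF W that] by (simp add: \<F>_def functor_category_def)
  have Wu: "nat_trans A set_category (FObj W i) (FObj W j) (FHom W i j u)"
    if "i \<in> Obj J" "j \<in> Obj J" "u \<in> Hom J i j" for i j u
    using functor_hom[OF W that] by (simp add: \<F>_def functor_category_def)
  have \<F>_Hom: "\<tau> \<in> Hom \<F> X Y \<longleftrightarrow> nat_trans A set_category X Y \<tau>" for X Y \<tau>
    by (simp add: \<F>_def functor_category_def)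
  have \<F>_comp: "Comp \<F> X Y Z \<sigma> \<tau> x p = \<sigma> x (\<tau> x p)"
    if "x \<in> Obj A" "p \<in> FObj X x" for X Y Z \<sigma> \<tau> x p
    using that by (simp add: \<F>_def functor_category_def set_category_def compose_def)
  obtain a d where univ: "\<And>j. j \<in> Obj J \<Longrightarrow> universal_element A (FObj W j) (a j) (d j)"
    using representable_universal_element[OF A rep] by metis
  have a: "a j \<in> Obj A" and d: "d j \<in> FObj (FObj W j) (a j)" if "j \<in> Obj J" for j
    using univ[OF that] by (simp_all add: universal_element_def)
  have \<kappa>: "nat_trans A set_category (FObj W j) P (\<kappa> j)" if "j \<in> Obj J" for j
    using colim that by (simp add: is_colimit_def is_cocone_def \<F>_def functor_category_def)
  have \<kappa>_cocone: "Comp \<F> (FObj W i) (FObj W j) P (\<kappa> j) (FHom W i j u) = \<kappa> i"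
    if "i \<in> Obj J" "j \<in> Obj J" "u \<in> Hom J i j" for i j u
    using colim that by (simp add: is_colimit_def is_cocone_def)
  \<comment> \<open>The colimit leg \<open>\<kappa> j\<close> goes out of a representable functor,
    so it amounts to a single element: a morphism \<open>b -> G (a j)\<close>.\<close>
  define \<xi> where "\<xi> j = \<kappa> j (a j) (d j)" for j
  have \<xi>: "\<xi> j \<in> FObj P (a j)" if "j \<in> Obj J" for j
    using \<kappa>[OF that] a[OF that] d[OF that]
    unfolding set_nat_trans_iff[OF Wj[OF that] P] \<xi>_def by auto

  \<comment> \<open>Full faithfulness of the Yoneda embedding: the transformation
    \<open>FHom W i j u\<close> corresponds to a morphism \<open>e i j u : a j -> a i\<close> in the
    reverse direction.\<close>
  define e where "e i j u = (THE f. f \<in> Hom A (a j) (a i) \<and>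
      FHom (FObj W j) (a j) (a i) f (d j) = FHom W i j u (a i) (d i))" for i j u
  have Wu_d: "FHom W i j u (a i) (d i) \<in> FObj (FObj W j) (a i)"
    if "i \<in> Obj J" "j \<in> Obj J" "u \<in> Hom J i j" for i j u
    using Wu[OF that] a d that unfolding set_nat_trans_iff[OF Wj[OF that(1)] Wj[OF that(2)]] by auto
  have e: "e i j u \<in> Hom A (a j) (a i)"
    "FHom (FObj W j) (a j) (a i) (e i j u) (d j) = FHom W i j u (a i) (d i)"
    if "i \<in> Obj J" "j \<in> Obj J" "u \<in> Hom J i j" for i j u
    using univ[OF that(2)] Wu_d[OF that] a[OF that(1)]
      theI'[of "\<lambda>f. f \<in> Hom A (a j) (a i) \<and>
      FHom (FObj W j) (a j) (a i) f (d j) = FHom W i j u (a i) (d i)"]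
    unfolding universal_element_def e_def by blast+
  \<comment> \<open>Contravariant functoriality of \<open>e\<close> comes from this uniqueness: two
    candidates are compared by their action on the universal element.\<close>
  have e_eq: "e i j u = f" if "i \<in> Obj J" "j \<in> Obj J" "u \<in> Hom J i j" "f \<in> Hom A (a j) (a i)"
    "FHom (FObj W j) (a j) (a i) f (d j) = FHom W i j u (a i) (d i)" for i j u f
    using univ[OF that(2)] Wu_d[OF that(1-3)] a[OF that(1)] that(4,5) e[OF that(1-3)]
    unfolding universal_element_def by blast
  have e_ident: "e i i (Ident J i) = Ident A (a i)" if i: "i \<in> Obj J" for i
  proof (rule e_eq)
    have "FHom W i i (Ident J i) (a i) (d i) = d i"
      using functor_ident[OF W i] a[OF i] d[OF i]
      by (simp add: \<F>_def functor_category_def set_category_def)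
    then show "FHom (FObj W i) (a i) (a i) (Ident A (a i)) (d i) = FHom W i i (Ident J i) (a i) (d i)"
      using set_functor_ident[OF Wj a d] i by simp
  qed (use i a catA catJ in \<open>auto intro: ident_in_hom\<close>)
  have e_comp: "e i k (Comp J i j k v u) = Comp A (a k) (a j) (a i) (e i j u) (e j k v)"
    if i: "i \<in> Obj J" and j: "j \<in> Obj J" and k: "k \<in> Obj J" and u: "u \<in> Hom J i j"
      and v: "v \<in> Hom J j k" for i j k u v
  proof (rule e_eq)
    have "FHom (FObj W k) (a k) (a i) (Comp A (a k) (a j) (a i) (e i j u) (e j k v)) (d k)
        = FHom (FObj W k) (a j) (a i) (e i j u) (FHom W j k v (a j) (d j))"
      using set_functor_comp[OF Wj[OF k] a[OF k] a[OF j] a[OF i] _ _ d[OF k]] e i j k u v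
      by simp
    also have "\<dots> = FHom W j k v (a i) (FHom (FObj W j) (a j) (a i) (e i j u) (d j))"
      using Wu[OF j k v] a d e i j u unfolding set_nat_trans_iff[OF Wj[OF j] Wj[OF k]] by blast
    also have "\<dots> = FHom W i k (Comp J i j k v u) (a i) (d i)"
      using functor_comp[OF W i j k u v] a d i by (simp add: e[OF i j u] \<F>_comp)
    finally show "FHom (FObj W k) (a k) (a i) (Comp A (a k) (a j) (a i) (e i j u) (e j k v)) (d k)
        = FHom W i k (Comp J i j k v u) (a i) (d i)" .
  qed (use that a catA catJ e in \<open>auto intro!: comp_in_hom\<close>)
  \<comment> \<open>This is the cocone condition on \<open>\<kappa>\<close>, evaluated at the
    universal element \<open>d i\<close>.\<close>
  have e_\<xi>: "FHom P (a j) (a i) (e i j u) (\<xi> j) = \<xi> i"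
    if i: "i \<in> Obj J" and j: "j \<in> Obj J" and u: "u \<in> Hom J i j" for i j u
  proof -
    have "FHom P (a j) (a i) (e i j u) (\<xi> j)
        = \<kappa> j (a i) (FHom (FObj W j) (a j) (a i) (e i j u) (d j))"
      using \<kappa>[OF j] a d e i j u unfolding set_nat_trans_iff[OF Wj[OF j] P] \<xi>_def by blast
    also have "\<dots> = \<kappa> i (a i) (d i)"
      using \<kappa>_cocone[OF i j u] \<F>_comp[OF a[OF i] d[OF i]] by (metis e(2)[OF i j u])
    finally show ?thesis by (simp add: \<xi>_def)
  qed

  define V :: "('u, 'u, 'd, 'u) functr" where
    "V = \<lparr>FObj = (\<lambda>j. FObj F (a j)), FHom = (\<lambda>j i u. FHom F (a j) (a i) (e i j u))\<rparr>"
  have V: "is_functor (opposite J) D V"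
    unfolding is_functor_def
    by (auto simp: V_def opposite_def e_ident e_comp a e functor_ident[OF F]
        intro!: functor_obj[OF F] functor_hom[OF F] functor_comp[OF F])
  obtain c \<pi> where lim: "is_limit D (opposite J) V c \<pi>"
    using complete small_category_opposite[OF J] V unfolding complete_category_def by blast
  have c: "c \<in> Obj D" using lim by (simp add: is_limit_def is_cone_def)
  have \<pi>: "\<pi> j \<in> Hom D c (FObj F (a j))" if "j \<in> Obj J" for j
    using lim that by (simp add: is_limit_def is_cone_def V_def opposite_def)
  have \<pi>_cone: "Comp D c (FObj F (a j)) (FObj F (a i)) (FHom F (a j) (a i) (e i j u)) (\<pi> j) = \<pi> i"
    if "i \<in> Obj J" "j \<in> Obj J" "u \<in> Hom J i j" for i j u
    using lim that by (simp add: is_limit_def is_cone_def V_def opposite_def)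

  let ?Q = "\<lambda>c. hom_functor D c \<circ>\<^sub>F F"
  have Q_apply: "FHom (?Q c) x y f k = Comp D c (FObj F x) (FObj F y) (FHom F x y f) k"
    if "k \<in> Hom D c (FObj F x)" for c x y f k
    using that by (simp add: hom_functor_def)
  \<comment> \<open>By the Yoneda lemma the limit projection \<open>\<pi> j\<close>, an element of
    \<open>D(c, F (a j))\<close>, is the value at \<open>d j\<close> of a transformation out of
    \<open>FObj W j\<close>.\<close>
  have "\<forall>j\<in>Obj J. \<exists>\<tau>. nat_trans A set_category (FObj W j) (?Q c) \<tau> \<and> \<tau> (a j) (d j) = \<pi> j"
  proof
    fix j assume j: "j \<in> Obj J"
    then show "\<exists>\<tau>. nat_trans A set_category (FObj W j) (?Q c) \<tau> \<and> \<tau> (a j) (d j) = \<pi> j"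
      using \<pi> by (intro universal_element_extend[OF catA Wj Q[OF c] univ]) (auto simp: hom_functor_def)
  qed
  then obtain \<tau> where \<tau>: "\<And>j. j \<in> Obj J \<Longrightarrow> nat_trans A set_category (FObj W j) (?Q c) (\<tau> j)"
    and \<tau>_d: "\<And>j. j \<in> Obj J \<Longrightarrow> \<tau> j (a j) (d j) = \<pi> j"
    by metis
  have \<F>_comp_nat: "nat_trans A set_category X Z (Comp \<F> X Y Z \<sigma> \<rho>)"
    if "is_functor A set_category X" "is_functor A set_category Y" "is_functor A set_category Z"
      "nat_trans A set_category X Y \<rho>" "nat_trans A set_category Y Z \<sigma>" for X Y Z \<sigma> \<rho>
    using nat_trans_comp[OF catA category_set_category that] by (simp add: \<F>_def functor_category_def)
  \<comment> \<open>Transformations out of \<open>FObj W i\<close> are determined at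
    \<open>d i\<close>, where the cocone condition on \<open>\<tau>\<close> becomes the cone
    condition on \<open>\<pi>\<close>.\<close>
  have "is_cocone \<F> J W (?Q c) \<tau>"
    unfolding is_cocone_def
  proof (intro conjI ballI)
    fix i j u assume i: "i \<in> Obj J" and j: "j \<in> Obj J" and u: "u \<in> Hom J i j"
    have "\<tau> j (a i) (FHom (FObj W j) (a j) (a i) (e i j u) (d j))
        = FHom (?Q c) (a j) (a i) (e i j u) (\<tau> j (a j) (d j))"
      using \<tau>[OF j] a d e i j u unfolding set_nat_trans_iff[OF Wj[OF j] Q[OF c]] by metis
    also have "\<dots> = \<pi> i"
      using \<pi>[OF j] \<pi>_cone[OF i j u] by (simp only: \<tau>_d[OF j] Q_apply)
    finally have "\<tau> j (a i) (FHom W i j u (a i) (d i)) = \<pi> i"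
      by (simp add: e(2)[OF i j u])
    then have "Comp \<F> (FObj W i) (FObj W j) (?Q c) (\<tau> j) (FHom W i j u) (a i) (d i) = \<tau> i (a i) (d i)"
      using \<F>_comp[OF a[OF i] d[OF i]] \<tau>_d[OF i] by simp
    then show "Comp \<F> (FObj W i) (FObj W j) (?Q c) (\<tau> j) (FHom W i j u) = \<tau> i"
      by (rule universal_element_eqI[OF Wj[OF i] Q[OF c] univ[OF i]
            \<F>_comp_nat[OF Wj[OF i] Wj[OF j] Q[OF c] Wu[OF i j u] \<tau>[OF j]] \<tau>[OF i]])
  qed (use Q[OF c] \<tau> in \<open>auto simp: \<F>_def functor_category_def\<close>)
  \<comment> \<open>The mediating transformation \<open>\<Theta>\<close> is the candidate for the
    universal weighted cone; it extends the limit projections from the generators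
    \<open>\<xi> j\<close> to all of \<open>B(b, G-)\<close>.\<close>
  then have "\<exists>!\<Theta>. \<Theta> \<in> Hom \<F> P (?Q c) \<and> (\<forall>j\<in>Obj J. Comp \<F> (FObj W j) P (?Q c) \<Theta> (\<kappa> j) = \<tau> j)"
    using colim unfolding is_colimit_def by blast
  then obtain \<Theta> where \<Theta>: "nat_trans A set_category P (?Q c) \<Theta>"
    and \<Theta>_\<kappa>: "\<And>j. j \<in> Obj J \<Longrightarrow> Comp \<F> (FObj W j) P (?Q c) \<Theta> (\<kappa> j) = \<tau> j"
    unfolding \<F>_Hom by blast
  have \<Theta>_\<xi>: "\<Theta> (a j) (\<xi> j) = \<pi> j" if "j \<in> Obj J" for j
    using \<Theta>_\<kappa>[OF that] \<F>_comp[OF a[OF that] d[OF that]] \<tau>_d[OF that] unfolding \<xi>_def by metis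

  text \<open>The colimit is jointly generated by the elements \<open>\<xi> j\<close>.\<close>
  have eqI: "\<sigma> = \<rho>" if c': "c' \<in> Obj D" and \<sigma>: "nat_trans A set_category P (?Q c') \<sigma>"
    and \<rho>: "nat_trans A set_category P (?Q c') \<rho>"
    and eq: "\<And>j. j \<in> Obj J \<Longrightarrow> \<sigma> (a j) (\<xi> j) = \<rho> (a j) (\<xi> j)" for c' \<sigma> \<rho>
  proof -
    have cat\<F>: "category \<F>"
      unfolding \<F>_def by (intro category_functor_category catA category_set_category)
    have ob: "P \<in> Obj \<F>" "?Q c' \<in> Obj \<F>" "\<And>j. j \<in> Obj J \<Longrightarrow> FObj W j \<in> Obj \<F>"
      using P Q[OF c'] Wj by (simp_all add: \<F>_def functor_category_def)
    have \<F>h: "\<sigma> \<in> Hom \<F> P (?Q c')" "\<rho> \<in> Hom \<F> P (?Q c')"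
      "\<And>j. j \<in> Obj J \<Longrightarrow> \<kappa> j \<in> Hom \<F> (FObj W j) P"
      "\<And>i j u. \<lbrakk>i \<in> Obj J; j \<in> Obj J; u \<in> Hom J i j\<rbrakk> \<Longrightarrow> FHom W i j u \<in> Hom \<F> (FObj W i) (FObj W j)"
      using \<sigma> \<rho> \<kappa> Wu by (simp_all add: \<F>_def functor_category_def)
    have "Comp \<F> (FObj W j) P (?Q c') \<sigma> (\<kappa> j) = Comp \<F> (FObj W j) P (?Q c') \<rho> (\<kappa> j)"
      if j: "j \<in> Obj J" for j
      using \<F>_comp[OF a[OF j] d[OF j]] eq[OF j]
      by (intro universal_element_eqI[OF Wj[OF j] Q[OF c'] univ[OF j]]
          \<F>_comp_nat[OF Wj[OF j] P Q[OF c'] \<kappa>[OF j]] \<sigma> \<rho>) (simp add: \<xi>_def)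
    \<comment> \<open>Agreement at \<open>\<xi> j\<close> has become agreement after composition
      with \<open>\<kappa> j\<close>, so \<open>\<sigma>\<close> and \<open>\<rho>\<close> both
      mediate this one cocone.\<close>
    moreover have "is_cocone \<F> J W (?Q c') (\<lambda>j. Comp \<F> (FObj W j) P (?Q c') \<rho> (\<kappa> j))"
      unfolding is_cocone_def
      using ob \<F>h \<kappa>_cocone by (auto simp: comp_assoc[OF cat\<F>] intro!: comp_in_hom[OF cat\<F>])
    ultimately show ?thesis
      using colim \<F>h(1,2) unfolding is_colimit_def by blast
  qed

  have P_obj: "FObj P x = Hom B b (FObj G x)" for x
    by (simp add: P_def hom_functor_def)
  have P_apply: "FHom P x y f h = Comp B b (FObj G x) (FObj G y) (FHom G x y f) h"
    if "h \<in> Hom B b (FObj G x)" for x y f h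
    using that by (simp add: P_def hom_functor_def)
  have \<Theta>_restrict: "(\<lambda>x\<in>Obj A. \<lambda>h\<in>Hom B b (FObj G x). \<Theta> x h) = \<Theta>"
  proof
    fix x
    have "\<Theta> \<in> extensional (Obj A)" "x \<in> Obj A \<Longrightarrow> \<Theta> x \<in> extensional (Hom B b (FObj G x))"
      using \<Theta> unfolding set_nat_trans_iff[OF P Q[OF c]] P_obj by (auto simp: PiE_def)
    then show "(\<lambda>x\<in>Obj A. \<lambda>h\<in>Hom B b (FObj G x). \<Theta> x h) x = \<Theta> x"
      by (cases "x \<in> Obj A") (simp_all add: extensional_restrict extensional_arb[where A = "Obj A"])
  qed
  have cone: "weighted_cone A B D G F b c \<Theta>"
    using \<Theta> unfolding weighted_cone_iff_nat_trans[OF B D G F b c] \<Theta>_restrict P_def .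
  have "weighted_limit A B D G F b c \<Theta>"
    unfolding weighted_limit_def
  proof (intro conjI allI impI cone)
    fix c' \<Lambda> assume \<Lambda>: "weighted_cone A B D G F b c' \<Lambda>"
    then have c': "c' \<in> Obj D" by (simp add: weighted_cone_def)
    \<comment> \<open>Evaluation at the generators turns a weighted cone into an ordinary cone; its
      compatibility is \<open>e_\<xi>\<close> combined with naturality of
      \<open>\<Lambda>\<close>.\<close>
    have "is_cone D (opposite J) V c' (\<lambda>j. \<Lambda> (a j) (\<xi> j))"
      unfolding is_cone_def
    proof (intro conjI ballI c')
      fix j i u assume "j \<in> Obj (opposite J)" "i \<in> Obj (opposite J)" "u \<in> Hom (opposite J) j i"
      then have i: "i \<in> Obj J" and j: "j \<in> Obj J" and u: "u \<in> Hom J i j"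
        by (simp_all add: opposite_def)
      have "Comp B b (FObj G (a j)) (FObj G (a i)) (FHom G (a j) (a i) (e i j u)) (\<xi> j) = \<xi> i"
        using e_\<xi>[OF i j u] \<xi>[OF j] by (simp add: P_apply P_obj)
      then show "Comp D c' (FObj V j) (FObj V i) (FHom V j i u) (\<Lambda> (a j) (\<xi> j)) = \<Lambda> (a i) (\<xi> i)"
        using \<Lambda> a e i j u \<xi> unfolding weighted_cone_def P_obj V_def by auto
    qed (use \<Lambda> a \<xi> in \<open>auto simp: weighted_cone_def P_obj V_def opposite_def\<close>)
    then have ex1: "\<exists>!k. k \<in> Hom D c' c \<and>
        (\<forall>j\<in>Obj J. Comp D c' c (FObj F (a j)) (\<pi> j) k = \<Lambda> (a j) (\<xi> j))"
      using lim unfolding is_limit_def by (simp add: opposite_def V_def)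
    \<comment> \<open>The ordinary and the weighted factorisation problems have the same solutions
      \<open>k\<close>. Forwards, \<open>\<Theta>\<close> composed with \<open>k\<close> is a
      weighted cone that agrees with \<open>\<Lambda>\<close> at the generators, hence everywhere;
      backwards, evaluate at \<open>\<xi> j\<close>.\<close>
    have "(\<forall>j\<in>Obj J. Comp D c' c (FObj F (a j)) (\<pi> j) k = \<Lambda> (a j) (\<xi> j)) \<longleftrightarrow>
       (\<forall>x\<in>Obj A. \<forall>h\<in>Hom B b (FObj G x). Comp D c' c (FObj F x) (\<Theta> x h) k = \<Lambda> x h)"
      if k: "k \<in> Hom D c' c" for k
    proof
      assume *: "\<forall>j\<in>Obj J. Comp D c' c (FObj F (a j)) (\<pi> j) k = \<Lambda> (a j) (\<xi> j)"
      let ?\<Lambda> = "\<lambda>x h. Comp D c' c (FObj F x) (\<Theta> x h) k"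
      have "weighted_cone A B D G F b c' ?\<Lambda>"
        using cone k c c' catD unfolding weighted_cone_def
        by (auto simp: comp_assoc[symmetric] functor_obj[OF F] functor_hom[OF F] intro: comp_in_hom)
      then have eq: "(\<lambda>x\<in>Obj A. \<lambda>h\<in>Hom B b (FObj G x). ?\<Lambda> x h)
          = (\<lambda>x\<in>Obj A. \<lambda>h\<in>Hom B b (FObj G x). \<Lambda> x h)"
        using \<Lambda> * \<Theta>_\<xi> a \<xi> unfolding weighted_cone_iff_nat_trans[OF B D G F b c']
        by (intro eqI[OF c']) (auto simp: P_def[symmetric] P_obj)
      show "\<forall>x\<in>Obj A. \<forall>h\<in>Hom B b (FObj G x). ?\<Lambda> x h = \<Lambda> x h"
      proof (intro ballI)
        fix x h assume "x \<in> Obj A" "h \<in> Hom B b (FObj G x)"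
        then show "?\<Lambda> x h = \<Lambda> x h"
          using restrict_eqD[OF restrict_eqD[OF eq]] by blast
      qed
    qed (use a \<xi> in \<open>auto simp: P_obj \<Theta>_\<xi>[symmetric]\<close>)
    then show "\<exists>!k. k \<in> Hom D c' c \<and>
        (\<forall>x\<in>Obj A. \<forall>h\<in>Hom B b (FObj G x). Comp D c' c (FObj F x) (\<Theta> x h) k = \<Lambda> x h)"
      using ex1 by (simp cong: conj_cong)
  qed
  then show ?thesis by blast
qed


section \<open>Right Kan extensions\<close>

text \<open>The pointwise construction. Morphisms into the vertex \<open>r b\<close> are determined
  by their composites with the universal cone, so functoriality, naturality and uniqueness are all
  checked on these composites.\<close>

lemma right_kan_extension_exists:
  assumes B: "category B" and D: "category D"
    and G: "is_functor A B G" and F: "is_functor A D F"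
    and lim: "\<And>b. b \<in> Obj B \<Longrightarrow> \<exists>c \<Lambda>. weighted_limit A B D G F b c \<Lambda>"
  shows "\<exists>R \<epsilon>. right_kan_extension A B D G F R \<epsilon>"
proof -
  obtain r \<Lambda> where lim: "\<And>b. b \<in> Obj B \<Longrightarrow> weighted_limit A B D G F b (r b) (\<Lambda> b)"
    using lim by metis
  have cone: "weighted_cone A B D G F b (r b) (\<Lambda> b)" if "b \<in> Obj B" for b
    using lim[OF that] by (simp add: weighted_limit_def)
  have r: "r b \<in> Obj D" if "b \<in> Obj B" for b
    using cone[OF that] by (simp add: weighted_cone_def)
  have \<Lambda>: "\<Lambda> b x h \<in> Hom D (r b) (FObj F x)"
    if "b \<in> Obj B" "x \<in> Obj A" "h \<in> Hom B b (FObj G x)" for b x h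
    using cone that by (simp add: weighted_cone_def)
  have \<Lambda>_natural: "Comp D (r b) (FObj F x) (FObj F y) (FHom F x y f) (\<Lambda> b x h)
      = \<Lambda> b y (Comp B b (FObj G x) (FObj G y) (FHom G x y f) h)"
    if "b \<in> Obj B" "x \<in> Obj A" "y \<in> Obj A" "f \<in> Hom A x y" "h \<in> Hom B b (FObj G x)" for b x y f h
    using cone that by (simp add: weighted_cone_def)
  have factor: "\<exists>!k. k \<in> Hom D c (r b) \<and>
      (\<forall>x\<in>Obj A. \<forall>h\<in>Hom B b (FObj G x). Comp D c (r b) (FObj F x) (\<Lambda> b x h) k = \<Lambda>' x h)"
    if "b \<in> Obj B" "weighted_cone A B D G F b c \<Lambda>'" for b c \<Lambda>'
    using lim[OF that(1)] that(2) unfolding weighted_limit_def by blast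
  \<comment> \<open>The legs of the universal cone are jointly monic: \<open>k\<close> and
    \<open>l\<close> both factor the cone obtained by composing with \<open>l\<close>.\<close>
  have eqI: "k = l" if b: "b \<in> Obj B" and c: "c \<in> Obj D"
    and k: "k \<in> Hom D c (r b)" and l: "l \<in> Hom D c (r b)"
    and eq: "\<And>x h. x \<in> Obj A \<Longrightarrow> h \<in> Hom B b (FObj G x) \<Longrightarrow>
      Comp D c (r b) (FObj F x) (\<Lambda> b x h) k = Comp D c (r b) (FObj F x) (\<Lambda> b x h) l" for b c k l
  proof -
    have "weighted_cone A B D G F b c (\<lambda>x h. Comp D c (r b) (FObj F x) (\<Lambda> b x h) l)"
      using b c l unfolding weighted_cone_def
      by (auto simp: comp_assoc[OF D, symmetric] \<Lambda>_natural functor_obj[OF F] functor_hom[OF F] r \<Lambda>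
          intro!: comp_in_hom[OF D])
    from factor[OF b this] show ?thesis using k l eq by blast
  qed
  note [simp] = functor_obj[OF F] functor_hom[OF F] functor_obj[OF G] functor_hom[OF G] r \<Lambda>
    comp_in_hom[OF B] comp_in_hom[OF D] ident_in_hom[OF B] ident_in_hom[OF D]
    comp_ident[OF B] comp_ident[OF D]

  \<comment> \<open>Precomposing the argument of \<open>\<Lambda> b\<close> with \<open>m\<close>
    gives a cone with vertex \<open>r b\<close> for the weight at \<open>b'\<close>; its
    factorisation is the action of \<open>R\<close> on \<open>m\<close>.\<close>
  have "\<exists>k. k \<in> Hom D (r b) (r b') \<and> (\<forall>x\<in>Obj A. \<forall>h\<in>Hom B b' (FObj G x).
      Comp D (r b) (r b') (FObj F x) (\<Lambda> b' x h) k = \<Lambda> b x (Comp B b b' (FObj G x) h m))"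
    if "b \<in> Obj B" "b' \<in> Obj B" "m \<in> Hom B b b'" for b b' m
  proof -
    have "weighted_cone A B D G F b' (r b) (\<lambda>x h. \<Lambda> b x (Comp B b b' (FObj G x) h m))"
      using that unfolding weighted_cone_def by (auto simp: \<Lambda>_natural comp_assoc[OF B])
    from factor[OF that(2) this] show ?thesis by blast
  qed
  then obtain rm where
    rm [simp]: "\<And>b b' m. \<lbrakk>b \<in> Obj B; b' \<in> Obj B; m \<in> Hom B b b'\<rbrakk> \<Longrightarrow> rm b b' m \<in> Hom D (r b) (r b')"
    and \<Lambda>_rm: "\<And>b b' m x h. \<lbrakk>b \<in> Obj B; b' \<in> Obj B; m \<in> Hom B b b'; x \<in> Obj A; h \<in> Hom B b' (FObj G x)\<rbrakk>
      \<Longrightarrow> Comp D (r b) (r b') (FObj F x) (\<Lambda> b' x h) (rm b b' m) = \<Lambda> b x (Comp B b b' (FObj G x) h m)"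
    by metis
  define R where "R = \<lparr>FObj = r, FHom = rm\<rparr>"
  have R: "is_functor B D R"
    unfolding is_functor_def R_def
  proof (simp, intro conjI ballI)
    fix b assume b: "b \<in> Obj B"
    show "rm b b (Ident B b) = Ident D (r b)"
      by (rule eqI[of b "r b"]) (simp_all add: \<Lambda>_rm b)
  next
    fix b1 b2 b3 f g
    assume b: "b1 \<in> Obj B" "b2 \<in> Obj B" "b3 \<in> Obj B" and fg: "f \<in> Hom B b1 b2" "g \<in> Hom B b2 b3"
    show "rm b1 b3 (Comp B b1 b2 b3 g f) = Comp D (r b1) (r b2) (r b3) (rm b2 b3 g) (rm b1 b2 f)"
    proof (rule eqI[of b3 "r b1"])
      fix x h assume "x \<in> Obj A" "h \<in> Hom B b3 (FObj G x)"
      then show "Comp D (r b1) (r b3) (FObj F x) (\<Lambda> b3 x h) (rm b1 b3 (Comp B b1 b2 b3 g f))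
        = Comp D (r b1) (r b3) (FObj F x) (\<Lambda> b3 x h)
            (Comp D (r b1) (r b2) (r b3) (rm b2 b3 g) (rm b1 b2 f))"
        using b fg by (simp add: \<Lambda>_rm comp_assoc[OF B] comp_assoc[OF D, symmetric])
    qed (use b fg in simp_all)
  qed
  \<comment> \<open>Evaluation at the identity of \<open>G x\<close>, as in the Yoneda lemma.
    Conversely, \<open>\<Lambda>_rm\<close> recovers \<open>\<Lambda> b x h\<close> as
    \<open>\<epsilon> x\<close> after the action of \<open>R\<close> on \<open>h\<close>.\<close>
  define \<epsilon> where "\<epsilon> = (\<lambda>x\<in>Obj A. \<Lambda> (FObj G x) x (Ident B (FObj G x)))"
  have \<epsilon>: "nat_trans A D (R \<circ>\<^sub>F G) F \<epsilon>"
    unfolding nat_trans_def by (simp add: \<epsilon>_def R_def \<Lambda>_natural \<Lambda>_rm)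
  have "right_kan_extension A B D G F R \<epsilon>"
    unfolding right_kan_extension_def
  proof (intro conjI allI impI R \<epsilon>)
    fix H \<alpha> assume "is_functor B D H \<and> nat_trans A D (H \<circ>\<^sub>F G) F \<alpha>"
    then have H: "is_functor B D H" and \<alpha>: "nat_trans A D (H \<circ>\<^sub>F G) F \<alpha>" by auto
    note [simp] = functor_obj[OF H] functor_hom[OF H] nat_trans_hom[OF \<alpha>, simplified]
      functor_ident[OF H]
    \<comment> \<open>This composite is forced: for a factorisation \<open>\<beta>\<close> of
      \<open>\<alpha>\<close>, naturality at \<open>h\<close> turns
      \<open>\<epsilon> x . R h . \<beta> b\<close> into
      \<open>\<epsilon> x . \<beta> (G x) . H h\<close>, which is
      \<open>\<alpha> x . H h\<close>.\<close>
    let ?\<Lambda> = "\<lambda>b x h. Comp D (FObj H b) (FObj H (FObj G x)) (FObj F x) (\<alpha> x) (FHom H b (FObj G x) h)"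
    have "\<exists>k. k \<in> Hom D (FObj H b) (r b) \<and> (\<forall>x\<in>Obj A. \<forall>h\<in>Hom B b (FObj G x).
        Comp D (FObj H b) (r b) (FObj F x) (\<Lambda> b x h) k = ?\<Lambda> b x h)" if b: "b \<in> Obj B" for b
    proof -
      have "weighted_cone A B D G F b (FObj H b) (?\<Lambda> b)"
        unfolding weighted_cone_def
      proof (intro conjI ballI)
        fix x y f h assume x: "x \<in> Obj A" "y \<in> Obj A" "f \<in> Hom A x y" "h \<in> Hom B b (FObj G x)"
        then have "Comp D (FObj H b) (FObj F x) (FObj F y) (FHom F x y f) (?\<Lambda> b x h)
            = Comp D (FObj H b) (FObj H (FObj G x)) (FObj F y)
                (Comp D (FObj H (FObj G x)) (FObj F x) (FObj F y) (FHom F x y f) (\<alpha> x))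
                (FHom H b (FObj G x) h)"
          using b by (simp add: comp_assoc[OF D])
        also have "\<dots> = ?\<Lambda> b y (Comp B b (FObj G x) (FObj G y) (FHom G x y f) h)"
          using b x nat_trans_natural[OF \<alpha> x(1-3)] by (simp add: comp_assoc[OF D] functor_comp[OF H])
        finally show "Comp D (FObj H b) (FObj F x) (FObj F y) (FHom F x y f) (?\<Lambda> b x h)
            = ?\<Lambda> b y (Comp B b (FObj G x) (FObj G y) (FHom G x y f) h)" .
      qed (use b in simp_all)
      from factor[OF b this] show ?thesis by blast
    qed
    then obtain \<beta>0 where \<beta>0 [simp]: "\<And>b. b \<in> Obj B \<Longrightarrow> \<beta>0 b \<in> Hom D (FObj H b) (r b)"
      and \<Lambda>_\<beta>0: "\<And>b x h. \<lbrakk>b \<in> Obj B; x \<in> Obj A; h \<in> Hom B b (FObj G x)\<rbrakk> \<Longrightarrow>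
        Comp D (FObj H b) (r b) (FObj F x) (\<Lambda> b x h) (\<beta>0 b) = ?\<Lambda> b x h"
      by metis
    define \<beta> where "\<beta> = restrict \<beta>0 (Obj B)"
    have "nat_trans B D H R \<beta>"
      unfolding nat_trans_def
    proof (intro conjI ballI)
      fix b b' m assume b: "b \<in> Obj B" "b' \<in> Obj B" and m: "m \<in> Hom B b b'"
      have "Comp D (FObj H b) (r b) (r b') (rm b b' m) (\<beta>0 b)
          = Comp D (FObj H b) (FObj H b') (r b') (\<beta>0 b') (FHom H b b' m)"
      proof (rule eqI[of b' "FObj H b"])
        fix x h assume "x \<in> Obj A" "h \<in> Hom B b' (FObj G x)"
        then show "Comp D (FObj H b) (r b') (FObj F x) (\<Lambda> b' x h)
              (Comp D (FObj H b) (r b) (r b') (rm b b' m) (\<beta>0 b))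
            = Comp D (FObj H b) (r b') (FObj F x) (\<Lambda> b' x h)
              (Comp D (FObj H b) (FObj H b') (r b') (\<beta>0 b') (FHom H b b' m))"
          using b m by (simp add: comp_assoc[OF D, symmetric] \<Lambda>_rm \<Lambda>_\<beta>0)
            (simp add: comp_assoc[OF D] functor_comp[OF H])
      qed (use b m in simp_all)
      then show "Comp D (FObj H b) (FObj R b) (FObj R b') (FHom R b b' m) (\<beta> b)
          = Comp D (FObj H b) (FObj H b') (FObj R b') (\<beta> b') (FHom H b b' m)"
        using b by (simp add: \<beta>_def R_def)
    qed (simp_all add: \<beta>_def R_def)
    moreover have "\<forall>x\<in>Obj A. Comp D (FObj H (FObj G x)) (FObj R (FObj G x)) (FObj F x)
        (\<epsilon> x) (\<beta> (FObj G x)) = \<alpha> x"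
      by (simp add: \<epsilon>_def \<beta>_def R_def \<Lambda>_\<beta>0)
    moreover have "\<gamma> = \<beta>" if \<gamma>: "nat_trans B D H R \<gamma>"
      and \<epsilon>\<gamma>: "\<forall>x\<in>Obj A. Comp D (FObj H (FObj G x)) (FObj R (FObj G x)) (FObj F x)
        (\<epsilon> x) (\<gamma> (FObj G x)) = \<alpha> x" for \<gamma>
    proof (rule nat_trans_eqI[OF \<gamma> \<open>nat_trans B D H R \<beta>\<close>])
      have \<gamma>_in [simp]: "\<gamma> b \<in> Hom D (FObj H b) (r b)" if "b \<in> Obj B" for b
        using nat_trans_hom[OF \<gamma> that] by (simp add: R_def)
      fix b assume b: "b \<in> Obj B"
      have "\<gamma> b = \<beta>0 b"
      proof (rule eqI[of b "FObj H b"])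
        fix x h assume x: "x \<in> Obj A" and h: "h \<in> Hom B b (FObj G x)"
        let ?g = "FObj G x"
        have "\<Lambda> b x h = Comp D (r b) (r ?g) (FObj F x) (\<epsilon> x) (rm b ?g h)"
          using b x h by (simp add: \<epsilon>_def \<Lambda>_rm)
        then have "Comp D (FObj H b) (r b) (FObj F x) (\<Lambda> b x h) (\<gamma> b)
            = Comp D (FObj H b) (r ?g) (FObj F x) (\<epsilon> x)
                (Comp D (FObj H b) (r b) (r ?g) (rm b ?g h) (\<gamma> b))"
          using b x h by (simp add: comp_assoc[OF D] \<epsilon>_def)
        also have "\<dots> = Comp D (FObj H b) (FObj H ?g) (FObj F x)
            (Comp D (FObj H ?g) (r ?g) (FObj F x) (\<epsilon> x) (\<gamma> ?g)) (FHom H b ?g h)"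
          using nat_trans_natural[OF \<gamma> b _ h] b x h by (simp add: comp_assoc[OF D] R_def \<epsilon>_def)
        also have "\<dots> = ?\<Lambda> b x h"
          using \<epsilon>\<gamma> x by (simp add: R_def)
        finally show "Comp D (FObj H b) (r b) (FObj F x) (\<Lambda> b x h) (\<gamma> b)
            = Comp D (FObj H b) (r b) (FObj F x) (\<Lambda> b x h) (\<beta>0 b)"
          using b x h by (simp add: \<Lambda>_\<beta>0)
      qed (use b in simp_all)
      then show "\<gamma> b = \<beta> b" using b by (simp add: \<beta>_def)
    qed
    ultimately show "\<exists>!\<beta>. nat_trans B D H R \<beta> \<and>
        (\<forall>x\<in>Obj A. Comp D (FObj H (FObj G x)) (FObj R (FObj G x)) (FObj F x)
          (\<epsilon> x) (\<beta> (FObj G x)) = \<alpha> x)"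
      by blast
  qed
  then show ?thesis by blast
qed

text \<open>Both transformations factor the single transformation with components
  \<open>\<epsilon> x . \<gamma> (G x)\<close>, so the uniqueness clause of the Kan extension
  identifies them.\<close>

lemma right_kan_extension_eqI:
  assumes A: "category A" and D: "category D" and G: "is_functor A B G" and F: "is_functor A D F"
    and kan: "right_kan_extension A B D G F R \<epsilon>" and H: "is_functor B D H"
    and \<beta>: "nat_trans B D H R \<beta>" and \<gamma>: "nat_trans B D H R \<gamma>"
    and eq: "\<And>x. x \<in> Obj A \<Longrightarrow>
      Comp D (FObj H (FObj G x)) (FObj R (FObj G x)) (FObj F x) (\<epsilon> x) (\<beta> (FObj G x))
        = Comp D (FObj H (FObj G x)) (FObj R (FObj G x)) (FObj F x) (\<epsilon> x) (\<gamma> (FObj G x))"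
  shows "\<beta> = \<gamma>"
proof -
  have R: "is_functor B D R" and \<epsilon>: "nat_trans A D (R \<circ>\<^sub>F G) F \<epsilon>"
    using kan by (simp_all add: right_kan_extension_def)
  let ?\<alpha> = "\<lambda>x\<in>Obj A. Comp D (FObj H (FObj G x)) (FObj R (FObj G x)) (FObj F x) (\<epsilon> x) (\<gamma> (FObj G x))"
  have "nat_trans A D (H \<circ>\<^sub>F G) F ?\<alpha>"
    using nat_trans_comp[OF A D is_functor_comp_functor[OF G H] is_functor_comp_functor[OF G R] F
        nat_trans_whisker_right[OF G \<gamma>] \<epsilon>]
    by (simp cong: restrict_cong)
  then have "\<exists>!\<beta>. nat_trans B D H R \<beta> \<and>
      (\<forall>x\<in>Obj A. Comp D (FObj H (FObj G x)) (FObj R (FObj G x)) (FObj F x)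
                   (\<epsilon> x) (\<beta> (FObj G x)) = ?\<alpha> x)"
    using kan H unfolding right_kan_extension_def by blast
  then show ?thesis using \<beta> \<gamma> eq by auto
qed


section \<open>The pushforward monad\<close>

text \<open>A formal argument from the universal property of \<open>R\<close>, which is used for
  sources \<open>id_functor\<close>, \<open>R\<close>, \<open>R R\<close> and
  \<open>R R R\<close>.\<close>

lemma pushforward_exists:
  assumes A: "category A" and B: "category B" and G: "is_functor A B G"
    and monad: "monad A T \<eta> \<mu>" and kan: "right_kan_extension A B B G (G \<circ>\<^sub>F T) R \<epsilon>"
  shows "\<exists>\<eta>' \<mu>'. is_pushforward A B G T \<eta> \<mu> R \<epsilon> \<eta>' \<mu>'"
proof -
  have T: "is_functor A A T" and \<eta>: "nat_trans A A id_functor T \<eta>"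
    and \<mu>: "nat_trans A A (T \<circ>\<^sub>F T) T \<mu>"
    using monad by (simp_all add: monad_def)
  have R: "is_functor B B R" and \<epsilon>: "nat_trans A B (R \<circ>\<^sub>F G) (G \<circ>\<^sub>F T) \<epsilon>"
    using kan by (simp_all add: right_kan_extension_def)
  note GT = is_functor_comp_functor[OF T G] and RR = is_functor_comp_functor[OF R R]
  note TT = is_functor_comp_functor[OF T T] and RG = is_functor_comp_functor[OF G R]
  note RRR = is_functor_comp_functor[OF RR R] and RRG = is_functor_comp_functor[OF RG R]
  note I = is_functor_id_functor[of B]
  note [simp] = functor_obj[OF G] functor_hom[OF G] functor_obj[OF T] functor_hom[OF T]
    functor_obj[OF R] functor_hom[OF R] comp_in_hom[OF A] comp_in_hom[OF B]
    ident_in_hom[OF A] ident_in_hom[OF B] comp_ident[OF A] comp_ident[OF B]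
    functor_ident[OF G] functor_ident[OF R]
    nat_trans_hom[OF \<eta>, simplified] nat_trans_hom[OF \<mu>, simplified] nat_trans_hom[OF \<epsilon>, simplified]
  have factor: "\<exists>!\<beta>. nat_trans B B H R \<beta> \<and>
      (\<forall>x\<in>Obj A. Comp B (FObj H (FObj G x)) (FObj R (FObj G x)) (FObj G (FObj T x))
        (\<epsilon> x) (\<beta> (FObj G x)) = \<alpha> x)"
    if "is_functor B B H" "nat_trans A B (H \<circ>\<^sub>F G) (G \<circ>\<^sub>F T) \<alpha>" for H \<alpha>
    using kan that unfolding right_kan_extension_def by simp
  note eqI = right_kan_extension_eqI[OF A B G GT kan, simplified]

  have "nat_trans A B (id_functor \<circ>\<^sub>F G) (G \<circ>\<^sub>F T) (\<lambda>x\<in>Obj A. FHom G x (FObj T x) (\<eta> x))"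
    using nat_trans_whisker_left[OF is_functor_id_functor T G \<eta>] by simp
  from factor[OF I this] obtain \<eta>' where \<eta>': "nat_trans B B id_functor R \<eta>'"
    and \<epsilon>_\<eta>': "\<And>x. x \<in> Obj A \<Longrightarrow>
      Comp B (FObj G x) (FObj R (FObj G x)) (FObj G (FObj T x)) (\<epsilon> x) (\<eta>' (FObj G x))
        = FHom G x (FObj T x) (\<eta> x)"
    by auto
  let ?\<alpha> = "\<lambda>x. let t = FObj T x; tt = FObj T t; g = FObj G x; gt = FObj G t; gtt = FObj G tt;
            rg = FObj R g; rgt = FObj R gt; rrg = FObj R rg in
        Comp B rrg gtt gt (FHom G tt t (\<mu> x))
              (Comp B rrg rgt gtt (\<epsilon> t) (FHom R rg gt (\<epsilon> x)))"
  have "nat_trans A B (R \<circ>\<^sub>F (R \<circ>\<^sub>F G)) (G \<circ>\<^sub>F T) (restrict ?\<alpha> (Obj A))"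
  proof -
    \<comment> \<open>The prescribed composite is natural because it is built from these three
      whiskerings, of types \<open>R R G -> R G T\<close>, \<open>R G T -> G T T\<close> and
      \<open>G T T -> G T\<close>.\<close>
    note R\<epsilon> = nat_trans_whisker_left[OF RG GT R \<epsilon>]
    note \<epsilon>T = nat_trans_whisker_right[OF T \<epsilon>, unfolded comp_functor_assoc]
    note G\<mu> = nat_trans_whisker_left[OF TT T G \<mu>]
    note RGT = is_functor_comp_functor[OF GT R] and GTT = is_functor_comp_functor[OF TT G]
    show ?thesis
      using nat_trans_comp[OF A B RRG GTT GT nat_trans_comp[OF A B RRG RGT GTT R\<epsilon> \<epsilon>T] G\<mu>]
      by (simp add: Let_def cong: restrict_cong)
  qed
  then have "nat_trans A B ((R \<circ>\<^sub>F R) \<circ>\<^sub>F G) (G \<circ>\<^sub>F T) (restrict ?\<alpha> (Obj A))"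
    by (simp only: comp_functor_assoc)
  from factor[OF RR this] obtain \<mu>' where \<mu>': "nat_trans B B (R \<circ>\<^sub>F R) R \<mu>'"
    and \<epsilon>_\<mu>': "\<And>x. x \<in> Obj A \<Longrightarrow> Comp B (FObj R (FObj R (FObj G x))) (FObj R (FObj G x))
      (FObj G (FObj T x)) (\<epsilon> x) (\<mu>' (FObj G x)) = ?\<alpha> x"
    by auto
  note \<epsilon>_\<mu>' = \<epsilon>_\<mu>'[unfolded Let_def]
  note [simp] = nat_trans_hom[OF \<eta>', simplified] nat_trans_hom[OF \<mu>', simplified]

  have equations: "pushforward_equations A B G T \<eta> \<mu> R \<epsilon> \<eta>' \<mu>'"
    unfolding pushforward_equations_def Let_def by (simp add: \<epsilon>_\<eta>' \<epsilon>_\<mu>')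
  have unique: "\<eta>'' = \<eta>' \<and> \<mu>'' = \<mu>'"
    \<comment> \<open>The monad structure supplies naturality of \<open>\<eta>''\<close> and
      \<open>\<mu>''\<close>, and the equations fix their composites with
      \<open>\<epsilon>\<close>.\<close>
    if "monad B R \<eta>'' \<mu>''" "pushforward_equations A B G T \<eta> \<mu> R \<epsilon> \<eta>'' \<mu>''" for \<eta>'' \<mu>''
  proof
    show "\<eta>'' = \<eta>'"
      using that \<eta>' by (intro eqI[OF I])
        (simp_all add: monad_def pushforward_equations_def Let_def \<epsilon>_\<eta>')
    show "\<mu>'' = \<mu>'"
      using that \<mu>' by (intro eqI[OF RR])
        (simp_all add: monad_def pushforward_equations_def Let_def \<epsilon>_\<mu>')
  qed

  note monad_laws = monad[unfolded monad_def Let_def]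
  have T_unit: "Comp A (FObj T x) (FObj T (FObj T x)) (FObj T x) (\<mu> x) (\<eta> (FObj T x)) = Ident A (FObj T x)"
    "Comp A (FObj T x) (FObj T (FObj T x)) (FObj T x) (\<mu> x) (FHom T x (FObj T x) (\<eta> x))
      = Ident A (FObj T x)"
    and T_assoc: "Comp A (FObj T (FObj T (FObj T x))) (FObj T (FObj T x)) (FObj T x) (\<mu> x) (\<mu> (FObj T x))
      = Comp A (FObj T (FObj T (FObj T x))) (FObj T (FObj T x)) (FObj T x) (\<mu> x)
          (FHom T (FObj T (FObj T x)) (FObj T x) (\<mu> x))"
    if "x \<in> Obj A" for x
    using monad_laws that by auto
  note assoc = comp_assoc[OF B]
  note \<eta>'_nat = nat_trans_natural[OF \<eta>', simplified]
    and \<mu>'_nat = nat_trans_natural[OF \<mu>', simplified]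
    and \<epsilon>_nat = nat_trans_natural[OF \<epsilon>, simplified]

  \<comment> \<open>Cancelling \<open>\<epsilon>\<close> is possible for whole transformations only,
    not at one object of \<open>B\<close>. The laws are therefore proved as equalities of restricted
    families and read off at each object at the end.\<close>
  have unit_left: "(\<lambda>b\<in>Obj B. Comp B (FObj R b) (FObj R (FObj R b)) (FObj R b) (\<mu>' b) (\<eta>' (FObj R b)))
      = (\<lambda>b\<in>Obj B. Ident B (FObj R b))"
  proof (rule eqI[OF R])
    show "nat_trans B B R R
        (\<lambda>b\<in>Obj B. Comp B (FObj R b) (FObj R (FObj R b)) (FObj R b) (\<mu>' b) (\<eta>' (FObj R b)))"
      using nat_trans_comp[OF B B R RR R
          nat_trans_whisker_right[OF R \<eta>', simplified] \<mu>']
      by (simp cong: restrict_cong)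
    show "nat_trans B B R R (\<lambda>b\<in>Obj B. Ident B (FObj R b))"
      by (rule nat_trans_ident[OF B B R])
    fix x assume x [simp]: "x \<in> Obj A"
    let ?t = "FObj T x" let ?tt = "FObj T ?t"
    let ?g = "FObj G x" let ?gt = "FObj G ?t" let ?gtt = "FObj G ?tt"
    let ?rg = "FObj R ?g" let ?rgt = "FObj R ?gt" let ?rrg = "FObj R ?rg"
    have "Comp B ?rg ?rg ?gt (\<epsilon> x) (Comp B ?rg ?rrg ?rg (\<mu>' ?g) (\<eta>' ?rg))
        = Comp B ?rg ?rrg ?gt (Comp B ?rrg ?rg ?gt (\<epsilon> x) (\<mu>' ?g)) (\<eta>' ?rg)"
      by (simp add: assoc)
    also have "\<dots> = Comp B ?rg ?gtt ?gt (FHom G ?tt ?t (\<mu> x)) (Comp B ?rg ?rgt ?gtt (\<epsilon> ?t)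
        (Comp B ?rg ?rrg ?rgt (FHom R ?rg ?gt (\<epsilon> x)) (\<eta>' ?rg)))"
      by (simp add: \<epsilon>_\<mu>' assoc)
    \<comment> \<open>Naturality of \<open>\<eta>'\<close> at \<open>\<epsilon> x\<close> moves
      \<open>\<epsilon> x\<close> to the right, so that \<open>\<epsilon>\<close> meets
      \<open>\<eta>'\<close> at \<open>G (T x)\<close>.\<close>
    also have "\<dots> = Comp B ?rg ?gtt ?gt (FHom G ?tt ?t (\<mu> x))
        (Comp B ?rg ?gt ?gtt (Comp B ?gt ?rgt ?gtt (\<epsilon> ?t) (\<eta>' ?gt)) (\<epsilon> x))"
      by (simp add: \<eta>'_nat assoc)
    also have "\<dots> = Comp B ?rg ?gt ?gt
        (Comp B ?gt ?gtt ?gt (FHom G ?tt ?t (\<mu> x)) (FHom G ?t ?tt (\<eta> ?t))) (\<epsilon> x)"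
      by (simp add: \<epsilon>_\<eta>' assoc)
    also have "\<dots> = Comp B ?rg ?rg ?gt (\<epsilon> x) (Ident B ?rg)"
      by (simp add: functor_comp[OF G, symmetric] T_unit)
    finally show "Comp B ?rg ?rg ?gt (\<epsilon> x)
        ((\<lambda>b\<in>Obj B. Comp B (FObj R b) (FObj R (FObj R b)) (FObj R b) (\<mu>' b) (\<eta>' (FObj R b))) ?g)
      = Comp B ?rg ?rg ?gt (\<epsilon> x) ((\<lambda>b\<in>Obj B. Ident B (FObj R b)) ?g)"
      by simp
  qed
  have unit_right: "(\<lambda>b\<in>Obj B. Comp B (FObj R b) (FObj R (FObj R b)) (FObj R b) (\<mu>' b)
        (FHom R b (FObj R b) (\<eta>' b)))
      = (\<lambda>b\<in>Obj B. Ident B (FObj R b))"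
  proof (rule eqI[OF R])
    show "nat_trans B B R R (\<lambda>b\<in>Obj B. Comp B (FObj R b) (FObj R (FObj R b)) (FObj R b) (\<mu>' b)
        (FHom R b (FObj R b) (\<eta>' b)))"
      using nat_trans_comp[OF B B R RR R
          nat_trans_whisker_left[OF I R R \<eta>', simplified] \<mu>']
      by (simp cong: restrict_cong)
    show "nat_trans B B R R (\<lambda>b\<in>Obj B. Ident B (FObj R b))"
      by (rule nat_trans_ident[OF B B R])
    fix x assume x [simp]: "x \<in> Obj A"
    let ?t = "FObj T x" let ?tt = "FObj T ?t"
    let ?g = "FObj G x" let ?gt = "FObj G ?t" let ?gtt = "FObj G ?tt"
    let ?rg = "FObj R ?g" let ?rgt = "FObj R ?gt" let ?rrg = "FObj R ?rg"
    have "Comp B ?rg ?rg ?gt (\<epsilon> x) (Comp B ?rg ?rrg ?rg (\<mu>' ?g) (FHom R ?g ?rg (\<eta>' ?g)))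
        = Comp B ?rg ?rrg ?gt (Comp B ?rrg ?rg ?gt (\<epsilon> x) (\<mu>' ?g)) (FHom R ?g ?rg (\<eta>' ?g))"
      by (simp add: assoc)
    also have "\<dots> = Comp B ?rg ?gtt ?gt (FHom G ?tt ?t (\<mu> x)) (Comp B ?rg ?rgt ?gtt (\<epsilon> ?t)
        (FHom R ?g ?gt (Comp B ?g ?rg ?gt (\<epsilon> x) (\<eta>' ?g))))"
      by (simp add: \<epsilon>_\<mu>' assoc functor_comp[OF R])
    \<comment> \<open>Naturality of \<open>\<epsilon>\<close> at \<open>\<eta> x\<close>, after
      \<open>\<epsilon>\<close> and \<open>\<eta>'\<close> have been combined inside
      \<open>R\<close>.\<close>
    also have "\<dots> = Comp B ?rg ?gtt ?gt (FHom G ?tt ?t (\<mu> x))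
        (Comp B ?rg ?gt ?gtt (FHom G ?t ?tt (FHom T x ?t (\<eta> x))) (\<epsilon> x))"
      by (simp add: \<epsilon>_\<eta>' \<epsilon>_nat)
    also have "\<dots> = Comp B ?rg ?gt ?gt
        (Comp B ?gt ?gtt ?gt (FHom G ?tt ?t (\<mu> x)) (FHom G ?t ?tt (FHom T x ?t (\<eta> x)))) (\<epsilon> x)"
      by (simp add: assoc)
    also have "\<dots> = Comp B ?rg ?rg ?gt (\<epsilon> x) (Ident B ?rg)"
      by (simp add: functor_comp[OF G, symmetric] T_unit)
    finally show "Comp B ?rg ?rg ?gt (\<epsilon> x)
        ((\<lambda>b\<in>Obj B. Comp B (FObj R b) (FObj R (FObj R b)) (FObj R b) (\<mu>' b)
          (FHom R b (FObj R b) (\<eta>' b))) ?g)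
      = Comp B ?rg ?rg ?gt (\<epsilon> x) ((\<lambda>b\<in>Obj B. Ident B (FObj R b)) ?g)"
      by simp
  qed
  have mult_assoc: "(\<lambda>b\<in>Obj B. Comp B (FObj R (FObj R (FObj R b))) (FObj R (FObj R b)) (FObj R b)
        (\<mu>' b) (\<mu>' (FObj R b)))
      = (\<lambda>b\<in>Obj B. Comp B (FObj R (FObj R (FObj R b))) (FObj R (FObj R b)) (FObj R b)
        (\<mu>' b) (FHom R (FObj R (FObj R b)) (FObj R b) (\<mu>' b)))"
    (is "?l = ?r")
  proof (rule eqI[OF RRR])
    show "nat_trans B B (R \<circ>\<^sub>F (R \<circ>\<^sub>F R)) R ?l"
      using nat_trans_comp[OF B B RRR RR R
          nat_trans_whisker_right[OF R \<mu>', unfolded comp_functor_assoc] \<mu>']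
      by (simp cong: restrict_cong)
    show "nat_trans B B (R \<circ>\<^sub>F (R \<circ>\<^sub>F R)) R ?r"
      using nat_trans_comp[OF B B RRR RR R
          nat_trans_whisker_left[OF RR R R \<mu>'] \<mu>']
      by (simp cong: restrict_cong)
    fix x assume x [simp]: "x \<in> Obj A"
    let ?t = "FObj T x" let ?tt = "FObj T ?t" let ?ttt = "FObj T ?tt"
    let ?g = "FObj G x" let ?gt = "FObj G ?t" let ?gtt = "FObj G ?tt" let ?gttt = "FObj G ?ttt"
    let ?rg = "FObj R ?g" let ?rgt = "FObj R ?gt" let ?rgtt = "FObj R ?gtt"
    let ?rrg = "FObj R ?rg" let ?rrgt = "FObj R ?rgt" let ?rrrg = "FObj R ?rrg"
    let ?R\<epsilon> = "FHom R ?rg ?gt (\<epsilon> x)" let ?R\<epsilon>T = "FHom R ?rgt ?gtt (\<epsilon> ?t)"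
    let ?RR\<epsilon> = "FHom R ?rrg ?rgt ?R\<epsilon>" let ?G\<mu> = "FHom G ?tt ?t (\<mu> x)"
    \<comment> \<open>The threefold composite \<open>R R R G x -> G T T T x\<close> to which both
      sides reduce; what follows it on each side is the image under \<open>G\<close> of one side of
      the associativity law of \<open>T\<close>.\<close>
    let ?\<zeta> = "Comp B ?rrrg ?rgtt ?gttt (\<epsilon> ?tt) (Comp B ?rrrg ?rrgt ?rgtt ?R\<epsilon>T ?RR\<epsilon>)"
    have "Comp B ?rrrg ?rg ?gt (\<epsilon> x) (Comp B ?rrrg ?rrg ?rg (\<mu>' ?g) (\<mu>' ?rg))
        = Comp B ?rrrg ?rrg ?gt (Comp B ?rrg ?rg ?gt (\<epsilon> x) (\<mu>' ?g)) (\<mu>' ?rg)"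
      by (simp add: assoc)
    also have "\<dots> = Comp B ?rrrg ?gtt ?gt ?G\<mu> (Comp B ?rrrg ?rgt ?gtt (\<epsilon> ?t)
        (Comp B ?rrrg ?rrg ?rgt ?R\<epsilon> (\<mu>' ?rg)))"
      by (simp add: \<epsilon>_\<mu>' assoc)
    \<comment> \<open>Naturality of \<open>\<mu>'\<close> at \<open>\<epsilon> x\<close> brings
      \<open>\<mu>'\<close> to an object in the image of \<open>G\<close>, where its defining
      equation applies again.\<close>
    also have "\<dots> = Comp B ?rrrg ?gtt ?gt ?G\<mu> (Comp B ?rrrg ?rrgt ?gtt
        (Comp B ?rrgt ?rgt ?gtt (\<epsilon> ?t) (\<mu>' ?gt)) ?RR\<epsilon>)"
      by (simp add: \<mu>'_nat assoc)
    also have "\<dots> = Comp B ?rrrg ?gttt ?gt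
        (Comp B ?gttt ?gtt ?gt ?G\<mu> (FHom G ?ttt ?tt (\<mu> ?t))) ?\<zeta>"
      by (simp add: \<epsilon>_\<mu>' assoc)
    also have "\<dots> = Comp B ?rrrg ?gttt ?gt
        (Comp B ?gttt ?gtt ?gt ?G\<mu> (FHom G ?ttt ?tt (FHom T ?tt ?t (\<mu> x)))) ?\<zeta>"
      by (simp add: functor_comp[OF G, symmetric] T_assoc)
    finally have left: "Comp B ?rrrg ?rg ?gt (\<epsilon> x) (Comp B ?rrrg ?rrg ?rg (\<mu>' ?g) (\<mu>' ?rg)) = \<dots>" .
    have "Comp B ?rrrg ?rg ?gt (\<epsilon> x) (Comp B ?rrrg ?rrg ?rg (\<mu>' ?g) (FHom R ?rrg ?rg (\<mu>' ?g)))
        = Comp B ?rrrg ?rrg ?gt (Comp B ?rrg ?rg ?gt (\<epsilon> x) (\<mu>' ?g)) (FHom R ?rrg ?rg (\<mu>' ?g))"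
      by (simp add: assoc)
    also have "\<dots> = Comp B ?rrrg ?gtt ?gt ?G\<mu> (Comp B ?rrrg ?rgt ?gtt (\<epsilon> ?t)
        (FHom R ?rrg ?gt (Comp B ?rrg ?rg ?gt (\<epsilon> x) (\<mu>' ?g))))"
      by (simp add: \<epsilon>_\<mu>' assoc functor_comp[OF R, symmetric])
    \<comment> \<open>The equation for \<open>\<mu>'\<close> is applied inside \<open>R\<close>
      before \<open>R\<close> is distributed over the composite; naturality of
      \<open>\<epsilon>\<close> at \<open>\<mu> x\<close> then yields
      \<open>\<zeta>\<close>.\<close>
    also have "\<dots> = Comp B ?rrrg ?gtt ?gt ?G\<mu> (Comp B ?rrrg ?rgtt ?gtt
        (Comp B ?rgtt ?rgt ?gtt (\<epsilon> ?t) (FHom R ?gtt ?gt ?G\<mu>)) (Comp B ?rrrg ?rrgt ?rgtt ?R\<epsilon>T ?RR\<epsilon>))"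
      by (simp only: \<epsilon>_\<mu>'[OF x]) (simp add: assoc functor_comp[OF R])
    also have "\<dots> = Comp B ?rrrg ?gttt ?gt
        (Comp B ?gttt ?gtt ?gt ?G\<mu> (FHom G ?ttt ?tt (FHom T ?tt ?t (\<mu> x)))) ?\<zeta>"
      by (simp add: \<epsilon>_nat[symmetric] assoc)
    finally show "Comp B (FObj (R \<circ>\<^sub>F (R \<circ>\<^sub>F R)) ?g) ?rg ?gt (\<epsilon> x) (?l ?g)
      = Comp B (FObj (R \<circ>\<^sub>F (R \<circ>\<^sub>F R)) ?g) ?rg ?gt (\<epsilon> x) (?r ?g)"
      using left by simp
  qed
  have "monad B R \<eta>' \<mu>'"
    unfolding monad_def Let_def
    using R \<eta>' \<mu>' restrict_eqD[OF unit_left] restrict_eqD[OF unit_right] restrict_eqD[OF mult_assoc]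
    by simp
  then show ?thesis
    using kan equations unique unfolding is_pushforward_def by blast
qed

theorem proposition2p5:
  fixes A :: "('a, 'u) cat" and B :: "('b, 'u) cat"
    and G :: "('a, 'u, 'b, 'u) functr"
    and T :: "('a, 'u, 'a, 'u) functr" and \<eta> \<mu> :: "'a \<Rightarrow> 'u"
  assumes "universe TYPE('u)"
    and "locally_small A" and "locally_small B"
    and "representably_small A B G"
    and "complete_category B"
    and "monad A T \<eta> \<mu>"
  shows "\<exists>R \<epsilon> \<eta>' \<mu>'. is_pushforward A B G T \<eta> \<mu> R \<epsilon> \<eta>' \<mu>'"
proof -
  have A: "category A" and B: "category B" and G: "is_functor A B G" and T: "is_functor A A T"
    using assms by (simp_all add: locally_small_def representably_small_def monad_def)
  have "\<exists>c \<Lambda>. weighted_limit A B B G (G \<circ>\<^sub>F T) b c \<Lambda>" if "b \<in> Obj B" for b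
    using assms that
    by (intro weighted_limit_exists is_functor_comp_functor[OF T G] G)
      (simp_all add: representably_small_def)
  then obtain R \<epsilon> where "right_kan_extension A B B G (G \<circ>\<^sub>F T) R \<epsilon>"
    using right_kan_extension_exists[OF B B G is_functor_comp_functor[OF T G]] by blast
  then show ?thesis
    using pushforward_exists[OF A B G assms(6)] by blast
qed

end
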